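(* Let $\Delta\in\mathbb{N}$ and let $\mathbb{G}=(V,E,T)$ be a temporal graph with $\Delta$-slice degeneracy $d$. Then the procedure $\textsc{BronKerboschDelta}$ described in the context, run with initial call $P=\{(v,T)\mid v\in V\}$, $R=(\emptyset,T)$, $X=\emptyset$, enumerates all maximal $\Delta$-cliques of $\mathbb{G}$ in $O(3^{d/3}\cdot 2^{d}\cdot|V|\cdot|T|\cdot|E|)$ time.
   Context: A temporal graph $\mathbb{G}=(V,E,T)$ consists of a finite vertex set $V$, an integer time interval $T=[\alpha,\omega]$, and a set of time-edges $E\subseteq\binom{V}{2}\times T$. All intervals are intervals of integers; for an interval $J=[a,b]$ write $|J|=b-a$. A $\Delta$-clique is a tuple $(C,I=[a,b])$ with $C\subseteq V$, $b-a\ge\Delta$, $I\subseteq T$, such that for all $\tau\in[a,b-\Delta]$ and all distinct $v,w\in C$ there is $(\{v,w\},t)\in E$ with $t\in[\tau,\tau+\Delta]$. It is vertex-maximal if there is no $\Delta$-clique $(C',I')$ with $I\subseteq I'$ and $C\subsetneq C'$; time-maximal if there is no $\Delta$-clique $(C',I')$ with $I\subsetneq I'$ and $C\subseteq C'$; maximal if both. The degeneracy of a static graph $G$ is the smallest $d\in\mathbb{N}$ such that every subgraph of $G$ contains a vertex of degree at most $d$. $\mathbb{G}$ has $\Delta$-slice degeneracy $d$ if for all $t\in T$ the static graph $G_t=(V,E_t)$ with $E_t=\{\{v,w\}\mid (\{v,w\},t')\in E\text{ for some }t'\in[t,t+\Delta]\}$ has degeneracy at most $d$. A vertex-interval pair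 is a tuple $(v,I)$ with $v\in V$, $I\subseteq T$ an interval. $\Delta$-neighborhood: $N^{\Delta}(v,I)$ is the set of all $(w,I'=[a',b'])$ such that $b'-a'\ge\Delta$, $I'\subseteq I$, for every $\tau\in[a',b'-\Delta]$ there is $(\{v,w\},t)\in E$ with $t\in[\tau,\tau+\Delta]$, and $I'$ is inclusion-maximal among subintervals of $I$ with these properties. $\Delta$-cut: $Y\sqcap Z=\{(v,I\cap I')\mid (v,I)\in Y,\ (v,I')\in Z,\ |I\cap I'|\ge\Delta\}$. Procedure $\textsc{BronKerboschDelta}(P,R=(C,I),X)$: (1) if every $(w,I')\in P\cup X$ satisfies $I'\subsetneq I$, add $R$ to the solution; (2) for each $(v,I')\in P$ (iterating over the current $P$): set $R'=(C\cup\{v\},I')$, $P'=P\sqcap N^{\Delta}(v,I')$, $X'=X\sqcap N^{\Delta}(v,I')$, call $\textsc{BronKerboschDelta}(P',R',X')$, then remove $(v,I')$ from $P$ and add it to $X$.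
   Formalization: Exact enumeration is claimed only for Δ ≤ |T| (otherwise no Δ-clique exists, yet ({v},T) is reported), and in the time bound each of |V|, |T|, |E| is replaced by its maximum with 1, since the product may be 0 while the running time is positive. *)

theory Defs
  imports Complex_Main
begin

section \<open>Integer intervals\<close>

text \<open>The pair \<open>(a, b)\<close> stands for the integer interval \<open>{a..b}\<close>.  Its \<open>duration\<close> \<open>b - a\<close> is one
  less than the number of its points; an empty intersection has negative duration.\<close>

type_synonym interval = "int \<times> int"

fun points :: "interval \<Rightarrow> int set" where
  "points (a, b) = {a..b}"

fun duration :: "interval \<Rightarrow> int" where
  "duration (a, b) = b - a"

fun meet :: "interval \<Rightarrow> interval \<Rightarrow> interval" where
  "meet (a, b) (c, d) = (max a c, min b d)"

section \<open>Temporal graphs and their cliques\<close>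

type_synonym 'v time_edges = "('v set \<times> int) set"

definition temporal_graph :: "'v set \<Rightarrow> 'v time_edges \<Rightarrow> interval \<Rightarrow> bool" where
  "temporal_graph V E T \<longleftrightarrow>
     finite V \<and> fst T \<le> snd T \<and> E \<subseteq> {e. e \<subseteq> V \<and> card e = 2} \<times> points T"

definition in_contact :: "'v time_edges \<Rightarrow> nat \<Rightarrow> 'v \<Rightarrow> 'v \<Rightarrow> interval \<Rightarrow> bool" where
  "in_contact E \<Delta> v w I \<longleftrightarrow>
     (\<forall>\<tau>\<in>{fst I..snd I - int \<Delta>}. \<exists>t\<in>{\<tau>..\<tau> + int \<Delta>}. ({v, w}, t) \<in> E)"

definition delta_clique ::
    "'v set \<Rightarrow> 'v time_edges \<Rightarrow> interval \<Rightarrow> nat \<Rightarrow> 'v set \<Rightarrow> interval \<Rightarrow> bool" where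
  "delta_clique V E T \<Delta> C I \<longleftrightarrow>
     C \<subseteq> V \<and> int \<Delta> \<le> duration I \<and> points I \<subseteq> points T \<and>
     (\<forall>v\<in>C. \<forall>w\<in>C. v \<noteq> w \<longrightarrow> in_contact E \<Delta> v w I)"

definition vertex_maximal ::
    "'v set \<Rightarrow> 'v time_edges \<Rightarrow> interval \<Rightarrow> nat \<Rightarrow> 'v set \<Rightarrow> interval \<Rightarrow> bool" where
  "vertex_maximal V E T \<Delta> C I \<longleftrightarrow>
     \<not> (\<exists>C' I'. delta_clique V E T \<Delta> C' I' \<and> points I \<subseteq> points I' \<and> C \<subset> C')"

definition time_maximal ::
    "'v set \<Rightarrow> 'v time_edges \<Rightarrow> interval \<Rightarrow> nat \<Rightarrow> 'v set \<Rightarrow> interval \<Rightarrow> bool" where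
  "time_maximal V E T \<Delta> C I \<longleftrightarrow>
     \<not> (\<exists>C' I'. delta_clique V E T \<Delta> C' I' \<and> points I \<subset> points I' \<and> C \<subseteq> C')"

definition maximal_delta_clique ::
    "'v set \<Rightarrow> 'v time_edges \<Rightarrow> interval \<Rightarrow> nat \<Rightarrow> 'v set \<Rightarrow> interval \<Rightarrow> bool" where
  "maximal_delta_clique V E T \<Delta> C I \<longleftrightarrow>
     delta_clique V E T \<Delta> C I \<and> vertex_maximal V E T \<Delta> C I \<and> time_maximal V E T \<Delta> C I"

section \<open>Degeneracy\<close>

definition subgraph :: "'v set \<Rightarrow> 'v set set \<Rightarrow> 'v set \<Rightarrow> 'v set set \<Rightarrow> bool" where
  "subgraph W' F' W F \<longleftrightarrow> W' \<subseteq> W \<and> F' \<subseteq> F \<and> (\<forall>e\<in>F'. e \<subseteq> W')"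

text \<open>The subgraph without vertices has to be left out, since it has no vertex of any degree.\<close>

definition degeneracy :: "'v set \<Rightarrow> 'v set set \<Rightarrow> nat" where
  "degeneracy W F = (LEAST d. \<forall>W' F'. subgraph W' F' W F \<and> W' \<noteq> {} \<longrightarrow>
     (\<exists>v\<in>W'. card {e\<in>F'. v \<in> e} \<le> d))"

definition slice_edges :: "'v time_edges \<Rightarrow> nat \<Rightarrow> int \<Rightarrow> 'v set set" where
  "slice_edges E \<Delta> t = {e. \<exists>t'\<in>{t..t + int \<Delta>}. (e, t') \<in> E}"

definition has_slice_degeneracy ::
    "'v set \<Rightarrow> 'v time_edges \<Rightarrow> interval \<Rightarrow> nat \<Rightarrow> nat \<Rightarrow> bool" where
  "has_slice_degeneracy V E T \<Delta> d \<longleftrightarrow>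
     (\<forall>t\<in>points T. degeneracy V (slice_edges E \<Delta> t) \<le> d)"

section \<open>The procedure\<close>

type_synonym 'v vertex_interval = "'v \<times> interval"

definition neighborhood ::
    "'v time_edges \<Rightarrow> nat \<Rightarrow> 'v \<Rightarrow> interval \<Rightarrow> 'v vertex_interval set" where
  "neighborhood E \<Delta> v I =
     {(w, J). int \<Delta> \<le> duration J \<and> points J \<subseteq> points I \<and> in_contact E \<Delta> v w J \<and>
        \<not> (\<exists>J'. int \<Delta> \<le> duration J' \<and> points J' \<subseteq> points I \<and> in_contact E \<Delta> v w J' \<and>
               points J \<subset> points J')}"

definition cut ::
    "nat \<Rightarrow> 'v vertex_interval set \<Rightarrow> 'v vertex_interval set \<Rightarrow> 'v vertex_interval set" where
  "cut \<Delta> Y Z = {(v, meet I J) | v I J. (v, I) \<in> Y \<and> (v, J) \<in> Z \<and> int \<Delta> \<le> duration (meet I J)}"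

text \<open>Unit-cost random access model.  Vertices, time labels and pointers fit into a machine
  word, time-edges are stored ordered by time, and a set of vertex-interval pairs is stored as
  one bucket of intervals per vertex.

  \<^item> \<open>neighborhood\<close>: one pass over the time-edges, keeping for every vertex the interval that is
    currently being extended, and one step for each pair written.
  \<^item> \<open>cut \<Delta> Y Z\<close>: each pair \<open>(v, J)\<close> of \<open>Z\<close> is intersected in turn with each interval in the
    bucket of \<open>v\<close> in \<open>Y\<close>.
  \<^item> A clique is copied vertex by vertex, both when it is extended and when it is reported.
  \<^item> The test whether to report looks at every pair in \<open>P\<close> and \<open>X\<close>.\<close>

definition neighborhood_cost :: "'v time_edges \<Rightarrow> nat \<Rightarrow> 'v \<Rightarrow> interval \<Rightarrow> nat" where
  "neighborhood_cost E \<Delta> v I = 1 + card E + card (neighborhood E \<Delta> v I)"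

definition cut_cost :: "'v vertex_interval set \<Rightarrow> 'v vertex_interval set \<Rightarrow> nat" where
  "cut_cost Y Z = 1 + (\<Sum>(v, J)\<in>Z. 1 + card {I. (v, I) \<in> Y})"

definition copy_cost :: "'v set \<Rightarrow> nat" where
  "copy_cost C = 1 + card C"

definition test_cost :: "'v vertex_interval set \<Rightarrow> 'v vertex_interval set \<Rightarrow> nat" where
  "test_cost P X = 1 + card P + card X"

definition reportable ::
    "'v vertex_interval set \<Rightarrow> interval \<Rightarrow> 'v vertex_interval set \<Rightarrow> bool" where
  "reportable P I X \<longleftrightarrow> (\<forall>(w, J)\<in>P \<union> X. points J \<subset> points I)"

text \<open>\<open>pick\<close> fixes the order in which the loop runs through \<open>P\<close>.  The state \<open>(P, R, X)\<close> never
  recurs within an execution, so every order arises from some \<open>pick\<close>.\<close>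

type_synonym 'v iteration_order =
  "'v vertex_interval set \<Rightarrow> 'v set \<times> interval \<Rightarrow> 'v vertex_interval set \<Rightarrow> 'v vertex_interval"

definition valid_order :: "'v iteration_order \<Rightarrow> bool" where
  "valid_order pick \<longleftrightarrow> (\<forall>P R X. P \<noteq> {} \<longrightarrow> pick P R X \<in> P)"

text \<open>\<open>bk_call E \<Delta> pick P R X out n\<close>: the call with arguments \<open>P\<close>, \<open>R\<close>, \<open>X\<close> terminates after \<open>n\<close>
  steps, having reported the sequence \<open>out\<close>.  \<open>bk_loop\<close> does the same for the loop in its body,
  started with the current values of \<open>P\<close> and \<open>X\<close>.  Both are deterministic for a fixed \<open>pick\<close>, so
  termination is the existence of a result.\<close>

inductive
  bk_call :: "'v time_edges \<Rightarrow> nat \<Rightarrow> 'v iteration_order \<Rightarrow> 'v vertex_interval set \<Rightarrow>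
    'v set \<times> interval \<Rightarrow> 'v vertex_interval set \<Rightarrow> ('v set \<times> interval) list \<Rightarrow> nat \<Rightarrow> bool" and
  bk_loop :: "'v time_edges \<Rightarrow> nat \<Rightarrow> 'v iteration_order \<Rightarrow> 'v vertex_interval set \<Rightarrow>
    'v set \<times> interval \<Rightarrow> 'v vertex_interval set \<Rightarrow> ('v set \<times> interval) list \<Rightarrow> nat \<Rightarrow> bool"
  for E \<Delta> pick
where
  report:
    "\<lbrakk>reportable P I X; bk_loop E \<Delta> pick P (C, I) X out n\<rbrakk> \<Longrightarrow>
     bk_call E \<Delta> pick P (C, I) X ((C, I) # out) (test_cost P X + copy_cost C + n)"
| no_report:
    "\<lbrakk>\<not> reportable P I X; bk_loop E \<Delta> pick P (C, I) X out n\<rbrakk> \<Longrightarrow>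
     bk_call E \<Delta> pick P (C, I) X out (test_cost P X + n)"
| finish:
    "bk_loop E \<Delta> pick {} (C, I) X [] 1"
| iterate:
    "\<lbrakk>P \<noteq> {}; pick P (C, I) X = (v, I'); N = neighborhood E \<Delta> v I';
      bk_call E \<Delta> pick (cut \<Delta> P N) (insert v C, I') (cut \<Delta> X N) out1 n1;
      bk_loop E \<Delta> pick (P - {(v, I')}) (C, I) (insert (v, I') X) out2 n2\<rbrakk> \<Longrightarrow>
     bk_loop E \<Delta> pick P (C, I) X (out1 @ out2)
       (1 + copy_cost C + neighborhood_cost E \<Delta> v I' + cut_cost P N + cut_cost X N + n1 + n2)"

text \<open>The initial call; \<open>1 + card V + card E\<close> is the cost of reading the input and setting up \<open>P\<close>.\<close>

definition bron_kerbosch_delta ::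
    "'v set \<Rightarrow> 'v time_edges \<Rightarrow> interval \<Rightarrow> nat \<Rightarrow> 'v iteration_order \<Rightarrow>
     ('v set \<times> interval) list \<Rightarrow> nat \<Rightarrow> bool" where
  "bron_kerbosch_delta V E T \<Delta> pick out n \<longleftrightarrow>
     (\<exists>m. bk_call E \<Delta> pick {(v, T) | v. v \<in> V} ({}, T) {} out m \<and> n = 1 + card V + card E + m)"

end

theory Submission
  imports Defs
begin

text \<open>Call a clique \<open>(C, I)\<close> time-maximal if \<open>I\<close> cannot be extended.  Two runs of windows that
  share a window merge, so for fixed \<open>C\<close> the time-maximal \<open>I\<close> pairwise share no window.  The invariant
  of the procedure is that the current \<open>(C, I)\<close> is time-maximal and that \<open>P \<union> X\<close> is the set of
  all \<open>(w, J)\<close> with \<open>J\<close> inside \<open>I\<close> such that adding \<open>w\<close> gives a time-maximal clique on \<open>J\<close>.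
  Hence \<open>(C, I)\<close> is reported iff it is maximal, and every time-maximal clique is visited once.

  A time-maximal clique is determined by its vertices and its first window, where it is a static
  clique.  A \<open>d\<close>-degenerate graph on \<open>V\<close> has at most \<open>|V| 2^d\<close> nonempty cliques, so there are
  at most \<open>|T| |V| 2^d\<close> visits (up to a constant).  One visit costs \<open>O(|E|)\<close>, apart from the part
  of the \<open>\<Delta>\<close>-cuts caused by neighbours \<open>(w, J)\<close> of \<open>v\<close> with \<open>J\<close> starting later than the
  interval of the clique.  Each of these costs \<open>O(|T|)\<close>, and it is determined by the time-edge
  between \<open>v\<close> and \<open>w\<close> that ends the first window of \<open>J\<close>, together with the vertex set, a clique
  in the slice of that window.  So over all visits there are at most \<open>2 |E| |V| 2^d\<close> of them.  The
  factor \<open>3^(d/3)\<close> is slack.\<close>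

section \<open>Runs of consecutive windows\<close>

text \<open>Comparing endpoints agrees with inclusion of point sets as soon as the inner interval is
  nonempty, and it is open to linear arithmetic.\<close>

abbreviation inside :: "interval \<Rightarrow> interval \<Rightarrow> bool" where
  "inside J I \<equiv> fst I \<le> fst J \<and> snd J \<le> snd I"

text \<open>\<open>Q\<close> speaks about the start \<open>\<tau>\<close> of a window from
  \<open>\<tau>\<close> to \<open>\<tau> + \<Delta>\<close>. The first conjunct makes room for at
  least one window, so a run is never empty.\<close>

definition run :: "nat \<Rightarrow> (int \<Rightarrow> bool) \<Rightarrow> interval \<Rightarrow> bool" where
  "run \<Delta> Q J \<longleftrightarrow> fst J + int \<Delta> \<le> snd J \<and> (\<forall>\<tau>. fst J \<le> \<tau> \<and> \<tau> + int \<Delta> \<le> snd J \<longrightarrow> Q \<tau>)"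

definition maximal_run :: "nat \<Rightarrow> (int \<Rightarrow> bool) \<Rightarrow> interval \<Rightarrow> interval \<Rightarrow> bool" where
  "maximal_run \<Delta> Q I J \<longleftrightarrow> run \<Delta> Q J \<and> inside J I \<and>
     (\<forall>K. run \<Delta> Q K \<longrightarrow> inside K I \<longrightarrow> inside J K \<longrightarrow> K = J)"

lemma duration_eq: "duration J = snd J - fst J"
  by (cases J) simp

lemma points_eq: "points J = {fst J..snd J}"
  by (cases J) simp

lemma points_subset_iff: "fst J \<le> snd J \<Longrightarrow> points J \<subseteq> points I \<longleftrightarrow> inside J I"
  by (auto simp: points_eq)

lemma points_psubset_iff:
  assumes "fst J \<le> snd J" "fst I \<le> snd I"
  shows "points J \<subset> points I \<longleftrightarrow> inside J I \<and> J \<noteq> I"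
  using assms by (auto simp: psubset_eq points_subset_iff prod_eq_iff points_eq)

lemma meet_eq: "meet I J = (max (fst I) (fst J), min (snd I) (snd J))"
  by (cases I; cases J) simp

lemma inside_antisym: "inside I J \<Longrightarrow> inside J I \<Longrightarrow> I = J"
  by (auto simp: prod_eq_iff)

lemma run_length: "run \<Delta> Q J \<Longrightarrow> fst J + int \<Delta> \<le> snd J"
  by (simp add: run_def)

lemma run_first: "run \<Delta> Q J \<Longrightarrow> Q (fst J)"
  by (simp add: run_def)

lemma run_mono: "run \<Delta> Q J \<Longrightarrow> (\<And>\<tau>. Q \<tau> \<Longrightarrow> Q' \<tau>) \<Longrightarrow> run \<Delta> Q' J"
  by (simp add: run_def)

lemma run_inside:
  "run \<Delta> Q I \<Longrightarrow> inside J I \<Longrightarrow> fst J + int \<Delta> \<le> snd J \<Longrightarrow> run \<Delta> Q J"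
  by (auto simp: run_def)

lemma maximal_runD:
  assumes "maximal_run \<Delta> Q I J"
  shows "run \<Delta> Q J" "inside J I" "fst J + int \<Delta> \<le> snd J"
  using assms by (auto simp: maximal_run_def run_def)

text \<open>The hull of \<open>J\<close> and \<open>K\<close> is again a run. A window of the hull
  that leaves one of the two intervals on some side is displaced from the shared window towards that
  side, and therefore lies in the other interval. Overlap in fewer points than a window would not
  suffice.\<close>

lemma maximal_run_absorbs:
  assumes J: "maximal_run \<Delta> Q I J" and K: "run \<Delta> Q K" "inside K I"
    and M: "inside M J" "inside M K" "fst M + int \<Delta> \<le> snd M"
  shows "inside K J"
proof -
  let ?H = "(min (fst J) (fst K), max (snd J) (snd K))"
  have "run \<Delta> Q ?H"
    unfolding run_def
  proof (intro conjI allI impI)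
    show "fst ?H + int \<Delta> \<le> snd ?H"
      using M by auto
    fix \<tau> assume t: "fst ?H \<le> \<tau> \<and> \<tau> + int \<Delta> \<le> snd ?H"
    have "(fst J \<le> \<tau> \<and> \<tau> + int \<Delta> \<le> snd J) \<or> (fst K \<le> \<tau> \<and> \<tau> + int \<Delta> \<le> snd K)"
      using t M by auto
    then show "Q \<tau>"
      using maximal_runD(1)[OF J] K(1) by (auto simp: run_def)
  qed
  moreover have "inside ?H I" "inside J ?H"
    using maximal_runD(2)[OF J] K(2) by auto
  ultimately have "?H = J"
    using J unfolding maximal_run_def by blast
  then show ?thesis
    by (auto simp: prod_eq_iff)
qed

lemma maximal_run_unique:
  assumes "maximal_run \<Delta> Q I J" "maximal_run \<Delta> Q I K"
    and "inside M J" "inside M K" "fst M + int \<Delta> \<le> snd M"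
  shows "J = K"
  using maximal_run_absorbs[OF assms(1), of K M] maximal_run_absorbs[OF assms(2), of J M]
    maximal_runD[OF assms(1)] maximal_runD[OF assms(2)] assms(3-) by (simp add: inside_antisym)

text \<open>Equal starts mean a common first window. The start thus serves as the key by which
  maximal runs are counted later.\<close>

lemma maximal_run_unique_start:
  assumes "maximal_run \<Delta> Q I J" "maximal_run \<Delta> Q I K" "fst J = fst K"
  shows "J = K"
  using maximal_run_unique[OF assms(1,2), of "(fst J, fst J + int \<Delta>)"]
    maximal_runD[OF assms(1)] maximal_runD[OF assms(2)] assms(3) by simp

lemma finite_inside: "finite {J. fst J \<le> snd J \<and> inside J I}"
  by (rule finite_subset[of _ "{fst I..snd I} \<times> {fst I..snd I}"]) auto

text \<open>Among the finitely many runs between \<open>K\<close> and \<open>I\<close>, one of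
  largest duration is maximal.\<close>

lemma maximal_run_exists:
  assumes "run \<Delta> Q K" "inside K I"
  shows "\<exists>J. maximal_run \<Delta> Q I J \<and> inside K J"
proof -
  let ?S = "{J. run \<Delta> Q J \<and> inside J I \<and> inside K J}"
  have fin: "finite ?S"
    by (rule finite_subset[OF _ finite_inside[of I]]) (auto dest: run_length)
  have "K \<in> ?S"
    using assms by simp
  then have "Max (duration ` ?S) \<in> duration ` ?S"
    using fin by (intro Max_in) (blast intro: finite_imageI)+
  then obtain J where J: "J \<in> ?S" and "duration J = Max (duration ` ?S)"
    by (metis (no_types, lifting) imageE)
  then have max: "duration L \<le> duration J" if "L \<in> ?S" for L
    using Max_ge[of "duration ` ?S"] fin that by auto
  have "L = J" if "run \<Delta> Q L" "inside L I" "inside J L" for L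
    using max[of L] J that by (auto simp: duration_eq prod_eq_iff)
  then show ?thesis
    using J unfolding maximal_run_def by blast
qed

text \<open>Otherwise the run could be prolonged by one step to the left.\<close>

lemma maximal_run_start:
  assumes J: "maximal_run \<Delta> Q I J" and ne: "fst J \<noteq> fst I"
  shows "\<not> Q (fst J - 1)"
proof
  assume Q: "Q (fst J - 1)"
  have "run \<Delta> Q (fst J - 1, snd J)"
    unfolding run_def
  proof (intro conjI allI impI)
    fix \<tau> assume "fst (fst J - 1, snd J) \<le> \<tau> \<and> \<tau> + int \<Delta> \<le> snd (fst J - 1, snd J)"
    then have "\<tau> = fst J - 1 \<or> fst J \<le> \<tau> \<and> \<tau> + int \<Delta> \<le> snd J"
      by auto
    then show "Q \<tau>"
      using Q maximal_runD(1)[OF J] by (auto simp: run_def)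
  qed (use maximal_runD(3)[OF J] in auto)
  then have "(fst J - 1, snd J) = J"
    using maximal_runD(2)[OF J] ne J unfolding maximal_run_def by auto
  then show False
    by (simp add: prod_eq_iff)
qed

section \<open>Cliques as runs\<close>

text \<open>Phrased through \<open>slice_edges\<close>, so that
  \<open>joint E \<Delta> C \<tau>\<close> says that \<open>C\<close> is a clique in the static
  graph of the window starting at \<open>\<tau>\<close>.\<close>

definition linked :: "'v time_edges \<Rightarrow> nat \<Rightarrow> 'v \<Rightarrow> 'v \<Rightarrow> int \<Rightarrow> bool" where
  "linked E \<Delta> v w \<tau> \<longleftrightarrow> {v, w} \<in> slice_edges E \<Delta> \<tau>"

definition joint :: "'v time_edges \<Rightarrow> nat \<Rightarrow> 'v set \<Rightarrow> int \<Rightarrow> bool" where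
  "joint E \<Delta> C \<tau> \<longleftrightarrow> (\<forall>v\<in>C. \<forall>w\<in>C. v \<noteq> w \<longrightarrow> linked E \<Delta> v w \<tau>)"

lemma linked_commute: "linked E \<Delta> v w = linked E \<Delta> w v"
  by (simp add: linked_def insert_commute fun_eq_iff)

lemma joint_mono: "joint E \<Delta> D \<tau> \<Longrightarrow> C \<subseteq> D \<Longrightarrow> joint E \<Delta> C \<tau>"
  by (auto simp: joint_def)

lemma joint_insert:
  "joint E \<Delta> (insert w C) \<tau> \<longleftrightarrow> joint E \<Delta> C \<tau> \<and> (\<forall>u\<in>C - {w}. linked E \<Delta> u w \<tau>)"
  unfolding joint_def by (metis Diff_iff insert_iff linked_commute singletonD)

lemma run_linked_iff:
  "run \<Delta> (linked E \<Delta> v w) J \<longleftrightarrow> int \<Delta> \<le> duration J \<and> in_contact E \<Delta> v w J"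
  by (auto simp: run_def in_contact_def linked_def slice_edges_def duration_eq)

text \<open>Maximality by point sets and maximality by endpoints coincide, because every interval
  concerned contains a window and hence a point.\<close>

lemma neighborhood_iff:
  "(w, J) \<in> neighborhood E \<Delta> v I \<longleftrightarrow> maximal_run \<Delta> (linked E \<Delta> v w) I J"
proof -
  have *: "int \<Delta> \<le> duration K \<and> points K \<subseteq> points I \<and> in_contact E \<Delta> v w K \<longleftrightarrow>
      run \<Delta> (linked E \<Delta> v w) K \<and> inside K I" for K
    using points_subset_iff[of K I] by (auto simp: run_linked_iff duration_eq)
  have **: "points J \<subset> points K \<longleftrightarrow> inside J K \<and> J \<noteq> K"
    if "run \<Delta> (linked E \<Delta> v w) J" "run \<Delta> (linked E \<Delta> v w) K" for K
    using that by (intro points_psubset_iff) (auto dest: run_length)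
  have "(w, J) \<in> neighborhood E \<Delta> v I \<longleftrightarrow>
      (int \<Delta> \<le> duration J \<and> points J \<subseteq> points I \<and> in_contact E \<Delta> v w J) \<and>
      \<not> (\<exists>K. (int \<Delta> \<le> duration K \<and> points K \<subseteq> points I \<and> in_contact E \<Delta> v w K) \<and>
        points J \<subset> points K)"
    unfolding neighborhood_def by blast
  also have "\<dots> \<longleftrightarrow> maximal_run \<Delta> (linked E \<Delta> v w) I J"
    unfolding * maximal_run_def using ** by metis
  finally show ?thesis .
qed

lemma run_joint_iff:
  "run \<Delta> (joint E \<Delta> C) J \<longleftrightarrow>
     int \<Delta> \<le> duration J \<and> (\<forall>v\<in>C. \<forall>w\<in>C. v \<noteq> w \<longrightarrow> in_contact E \<Delta> v w J)"
proof -
  have "run \<Delta> (joint E \<Delta> C) J \<longleftrightarrow> fst J + int \<Delta> \<le> snd J \<and>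
      (\<forall>v\<in>C. \<forall>w\<in>C. v \<noteq> w \<longrightarrow> run \<Delta> (linked E \<Delta> v w) J)"
    unfolding run_def joint_def by blast
  then show ?thesis
    by (auto simp: run_linked_iff duration_eq)
qed

lemma delta_clique_iff:
  "delta_clique V E T \<Delta> C I \<longleftrightarrow> C \<subseteq> V \<and> run \<Delta> (joint E \<Delta> C) I \<and> inside I T"
  using points_subset_iff[of I T] by (auto simp: delta_clique_def run_joint_iff duration_eq)

section \<open>Cliques in degenerate graphs\<close>

text \<open>The empty clique is left out so that the bound \<open>card W * 2 ^ d\<close> also holds
  for empty \<open>W\<close>.\<close>

definition static_cliques :: "'v set \<Rightarrow> 'v set set \<Rightarrow> 'v set set" where
  "static_cliques W F = {D. D \<subseteq> W \<and> D \<noteq> {} \<and> (\<forall>v\<in>D. \<forall>w\<in>D. v \<noteq> w \<longrightarrow> {v, w} \<in> F)}"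

lemma finite_static_cliques: "finite W \<Longrightarrow> finite (static_cliques W F)"
  by (rule finite_subset[of _ "Pow W"]) (auto simp: static_cliques_def)

text \<open>Since \<open>degeneracy\<close> is a least number, some admissible number has to be
  exhibited first; \<open>card F\<close> bounds every degree in every subgraph.\<close>

lemma degeneracy_vertex:
  assumes "finite F" "degeneracy W F \<le> d" "subgraph W' F' W F" "W' \<noteq> {}"
  shows "\<exists>v\<in>W'. card {e\<in>F'. v \<in> e} \<le> d"
proof -
  let ?Q = "\<lambda>d. \<forall>W' F'. subgraph W' F' W F \<and> W' \<noteq> {} \<longrightarrow>
     (\<exists>v\<in>W'. card {e\<in>F'. v \<in> e} \<le> d)"
  have "?Q (card F)"
  proof (intro allI impI)
    fix W' F' assume a: "subgraph W' F' W F \<and> W' \<noteq> {}"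
    then obtain v where "v \<in> W'"
      by auto
    moreover have "card {e\<in>F'. v \<in> e} \<le> card F"
      using a assms(1) by (intro card_mono) (auto simp: subgraph_def)
    ultimately show "\<exists>v\<in>W'. card {e\<in>F'. v \<in> e} \<le> card F"
      by blast
  qed
  then have "?Q (degeneracy W F)"
    unfolding degeneracy_def by (rule LeastI)
  then show ?thesis
    using assms(2-) by (meson le_trans)
qed

text \<open>A clique containing a vertex of degree at most \<open>d\<close> is determined by a subset of the
  neighbours of that vertex; removing such vertices one by one exhausts all cliques.\<close>

lemma card_static_cliques_le:
  assumes F: "finite F" "degeneracy V F \<le> d" and W: "finite W" "W \<subseteq> V"
  shows "card (static_cliques W F) \<le> card W * 2 ^ d"
  using W
proof (induction "card W" arbitrary: W)
  case 0
  then show ?case by (auto simp: static_cliques_def)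
next
  case (Suc k)
  let ?F = "{e\<in>F. e \<subseteq> W}"
  have "subgraph W ?F V F" "W \<noteq> {}"
    using Suc.hyps(2) Suc.prems by (auto simp: subgraph_def)
  then obtain v where v: "v \<in> W" and deg: "card {e\<in>?F. v \<in> e} \<le> d"
    using degeneracy_vertex[OF F] by blast
  have finF: "finite {e\<in>?F. v \<in> e}"
    using F(1) by simp
  \<comment> \<open>A clique through \<open>v\<close> is encoded by its edges at \<open>v\<close>,
    which are among the at most \<open>d\<close> edges at \<open>v\<close> in the subgraph induced
    by \<open>W\<close>.\<close>
  let ?g = "\<lambda>D. (\<lambda>w. {v, w}) ` (D - {v})"
  let ?Cv = "{D\<in>static_cliques W F. v \<in> D}"
  have "inj_on ?g ?Cv"
  proof (rule inj_onI)
    fix D D' assume "D \<in> ?Cv" "D' \<in> ?Cv" "?g D = ?g D'"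
    moreover have "inj (\<lambda>w. {v, w})"
      by (auto simp: inj_def doubleton_eq_iff)
    ultimately have "D - {v} = D' - {v}" "v \<in> D" "v \<in> D'"
      by (simp_all add: inj_image_eq_iff)
    then show "D = D'"
      by blast
  qed
  moreover have "?g ` ?Cv \<subseteq> Pow {e\<in>?F. v \<in> e}"
    using v by (fastforce simp: static_cliques_def)
  ultimately have "card ?Cv \<le> card (Pow {e\<in>?F. v \<in> e})"
    using finF by (intro card_inj_on_le) auto
  also have "\<dots> \<le> 2 ^ d"
    using finF deg by (simp add: card_Pow power_increasing)
  finally have Cv: "card ?Cv \<le> 2 ^ d" .
  have "card (W - {v}) = k"
    using Suc.hyps(2) v Suc.prems(1) by simp
  then have rest: "card (static_cliques (W - {v}) F) \<le> k * 2 ^ d"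
    using Suc.hyps(1)[of "W - {v}"] Suc.prems by auto
  have "static_cliques W F = ?Cv \<union> static_cliques (W - {v}) F"
    by (auto simp: static_cliques_def)
  then have "card (static_cliques W F) \<le> card ?Cv + card (static_cliques (W - {v}) F)"
    by (metis card_Un_le)
  then show ?case
    using Cv rest Suc.hyps(2)[symmetric] by simp
qed

section \<open>Time-maximal cliques\<close>

lemma cut_iff:
  "(w, K) \<in> cut \<Delta> Y Z \<longleftrightarrow>
     (\<exists>I J. (w, I) \<in> Y \<and> (w, J) \<in> Z \<and> K = meet I J \<and> fst K + int \<Delta> \<le> snd K)"
proof -
  have "(w, K) \<in> cut \<Delta> Y Z \<longleftrightarrow>
      (\<exists>I J. (w, I) \<in> Y \<and> (w, J) \<in> Z \<and> K = meet I J \<and> int \<Delta> \<le> duration K)"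
    unfolding cut_def by blast
  then show ?thesis
    by (simp add: duration_eq le_diff_eq add.commute)
qed

lemma cut_Un: "cut \<Delta> (Y \<union> Y') Z = cut \<Delta> Y Z \<union> cut \<Delta> Y' Z"
  unfolding cut_def by blast

lemma cut_mono: "Y \<subseteq> Y' \<Longrightarrow> cut \<Delta> Y Z \<subseteq> cut \<Delta> Y' Z"
  unfolding cut_def by blast

lemma cut_empty: "cut \<Delta> Y {} = {}" "cut \<Delta> {} Z = {}"
  by (auto simp: cut_def)

text \<open>The contact must happen at the only time that belongs to the window at \<open>c\<close>
  but not to the one at \<open>c - 1\<close>, namely its last point.\<close>

lemma linked_start:
  assumes "linked E \<Delta> v w c" "\<not> linked E \<Delta> v w (c - 1)"
  shows "({v, w}, c + int \<Delta>) \<in> E"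
proof -
  obtain t where t: "c \<le> t" "t \<le> c + int \<Delta>" "({v, w}, t) \<in> E"
    using assms(1) by (auto simp: linked_def slice_edges_def)
  then have "\<not> t \<le> c - 1 + int \<Delta>"
    using assms(2) by (force simp: linked_def slice_edges_def)
  then show ?thesis
    using t by (simp add: antisym_conv)
qed

locale temporal =
  fixes V :: "'v set" and E :: "'v time_edges" and T :: interval and \<Delta> :: nat
  assumes graph: "temporal_graph V E T"
begin

text \<open>Here the vertex set stays fixed, whereas \<open>time_maximal\<close> lets it grow. For
  cliques both mean the same, since subsets of a clique are cliques on the same interval.\<close>

definition tmax :: "'v set \<Rightarrow> interval \<Rightarrow> bool" where
  "tmax C I \<longleftrightarrow> C \<subseteq> V \<and> maximal_run \<Delta> (joint E \<Delta> C) T I"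

text \<open>The pairs that \<open>P\<close> and \<open>X\<close> together have to contain when the current clique is \<open>(C, I)\<close>.\<close>

definition ext :: "'v set \<Rightarrow> interval \<Rightarrow> 'v vertex_interval set" where
  "ext C I = {(w, J). w \<in> V - C \<and> tmax (insert w C) J \<and> inside J I}"

text \<open>The cliques at which the loop for candidate set \<open>P\<close> and current vertex set \<open>C\<close> makes a
  recursive call.\<close>

definition visited :: "'v vertex_interval set \<Rightarrow> 'v set \<Rightarrow> ('v set \<times> interval) set" where
  "visited P C = {(D, K). C \<subset> D \<and> tmax D K \<and> (\<forall>w\<in>D - C. \<exists>J. (w, J) \<in> P \<and> inside K J)}"

lemma finite_V: "finite V"
  using graph by (simp add: temporal_graph_def)

lemma finite_E: "finite E"
  by (rule finite_subset[of _ "Pow V \<times> points T"])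
    (use graph in \<open>auto simp: temporal_graph_def points_eq finite_V\<close>)

lemma edgeD: "({v, w}, t) \<in> E \<Longrightarrow> v \<noteq> w \<and> v \<in> V \<and> w \<in> V"
  using graph by (auto simp: temporal_graph_def)

lemma linkedD: "linked E \<Delta> v w \<tau> \<Longrightarrow> v \<noteq> w \<and> v \<in> V \<and> w \<in> V"
  unfolding linked_def slice_edges_def by (auto dest: edgeD)

lemma neighborhoodD:
  assumes "(w, J) \<in> neighborhood E \<Delta> v I"
  shows "linked E \<Delta> v w (fst J)" "inside J I" "fst J + int \<Delta> \<le> snd J" "v \<noteq> w" "w \<in> V"
proof -
  have J: "maximal_run \<Delta> (linked E \<Delta> v w) I J"
    using assms by (simp add: neighborhood_iff)
  show l: "linked E \<Delta> v w (fst J)" "inside J I" "fst J + int \<Delta> \<le> snd J"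
    using maximal_runD[OF J] run_first[of \<Delta> "linked E \<Delta> v w" J] by auto
  show "v \<noteq> w" "w \<in> V"
    using linkedD[OF l(1)] by auto
qed

lemma finite_neighborhood: "finite (neighborhood E \<Delta> v I)"
proof (rule finite_subset)
  show "neighborhood E \<Delta> v I \<subseteq> V \<times> {J. fst J \<le> snd J \<and> inside J I}"
  proof
    fix x assume "x \<in> neighborhood E \<Delta> v I"
    then show "x \<in> V \<times> {J. fst J \<le> snd J \<and> inside J I}"
      using neighborhoodD[of "fst x" "snd x" v I] by (cases x) force
  qed
qed (simp add: finite_V finite_inside)

lemma tmaxD:
  assumes "tmax C I"
  shows "C \<subseteq> V" "run \<Delta> (joint E \<Delta> C) I" "inside I T" "fst I + int \<Delta> \<le> snd I"
  using assms by (auto simp: tmax_def dest: maximal_runD)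

lemma tmax_unique:
  assumes "tmax C I" "tmax C J" "inside M I" "inside M J" "fst M + int \<Delta> \<le> snd M"
  shows "I = J"
  using assms maximal_run_unique unfolding tmax_def by blast

lemma tmax_unique_start: "tmax C I \<Longrightarrow> tmax C J \<Longrightarrow> fst I = fst J \<Longrightarrow> I = J"
  using maximal_run_unique_start unfolding tmax_def by blast

text \<open>A run for a larger vertex set is also a run for \<open>C\<close>, so the maximal one
  swallows it once they share a window.\<close>

lemma tmax_absorbs:
  assumes C: "tmax C I" and D: "run \<Delta> (joint E \<Delta> D) K" "C \<subseteq> D" "inside K T"
    and M: "inside M I" "inside M K" "fst M + int \<Delta> \<le> snd M"
  shows "inside K I"
proof (rule maximal_run_absorbs[OF _ _ D(3) M])
  show "maximal_run \<Delta> (joint E \<Delta> C) T I"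
    using C by (simp add: tmax_def)
  show "run \<Delta> (joint E \<Delta> C) K"
    using D joint_mono by (blast intro: run_mono)
qed

lemma tmax_exists:
  assumes "C \<subseteq> V" "run \<Delta> (joint E \<Delta> C) K" "inside K T"
  shows "\<exists>I. tmax C I \<and> inside K I"
  using maximal_run_exists[OF assms(2,3)] assms(1) by (simp add: tmax_def)

lemma finite_tmax: "finite {(D, K). tmax D K}"
proof (rule finite_subset)
  show "{(D, K). tmax D K} \<subseteq> Pow V \<times> {J. fst J \<le> snd J \<and> inside J T}"
  proof
    fix x assume "x \<in> {(D, K). tmax D K}"
    then show "x \<in> Pow V \<times> {J. fst J \<le> snd J \<and> inside J T}"
      using tmaxD[of "fst x" "snd x"] by (cases x) auto
  qed
qed (simp add: finite_V finite_inside)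

lemma finite_ext: "finite (ext C I)"
proof (rule finite_subset)
  show "ext C I \<subseteq> V \<times> {J. fst J \<le> snd J \<and> inside J T}"
  proof
    fix x assume "x \<in> ext C I"
    then show "x \<in> V \<times> {J. fst J \<le> snd J \<and> inside J T}"
      using tmaxD[of "insert (fst x) C" "snd x"] by (cases x) (auto simp: ext_def)
  qed
qed (simp add: finite_V finite_inside)

lemma finite_visited: "finite (visited P C)"
  by (rule finite_subset[OF _ finite_tmax]) (auto simp: visited_def)

section \<open>How the cut with a neighborhood transforms the set of extensions\<close>

lemma meet_tmax:
  assumes v: "tmax (insert v C) I'" and w: "tmax (insert w C) J"
    and J': "(w, J') \<in> neighborhood E \<Delta> v I'"
    and len: "fst (meet J J') + int \<Delta> \<le> snd (meet J J')"
  shows "tmax (insert w (insert v C)) (meet J J')"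
proof -
  let ?D = "insert w (insert v C)" and ?M = "meet J J'"
  have M: "inside ?M J" "inside ?M J'" "inside ?M I'" "inside ?M T"
    using neighborhoodD(2)[OF J'] tmaxD(3)[OF v] by (auto simp: meet_eq)
  have lnk: "maximal_run \<Delta> (linked E \<Delta> v w) I' J'"
    using J' by (simp add: neighborhood_iff)
  have joint: "joint E \<Delta> ?D \<tau> \<longleftrightarrow>
      joint E \<Delta> (insert v C) \<tau> \<and> joint E \<Delta> (insert w C) \<tau> \<and> linked E \<Delta> v w \<tau>" for \<tau>
    using neighborhoodD(4)[OF J'] by (auto simp: joint_insert)
  have "run \<Delta> (joint E \<Delta> ?D) ?M"
    using run_inside[OF tmaxD(2)[OF v] M(3) len] run_inside[OF tmaxD(2)[OF w] M(1) len]
      run_inside[OF maximal_runD(1)[OF lnk] M(2) len]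
    unfolding run_def joint by blast
  \<comment> \<open>A run \<open>K\<close> beyond the meet contains that meet, so it shares a window
    with each of \<open>J\<close>, \<open>I'\<close> and \<open>J'\<close>; each of the three
    absorbs it, which puts \<open>K\<close> back inside the meet.\<close>
  moreover have "K = ?M"
    if K: "run \<Delta> (joint E \<Delta> ?D) K" "inside K T" "inside ?M K" for K
  proof -
    have 1: "inside K J"
      using tmax_absorbs[OF w K(1) _ K(2) M(1) K(3) len] by blast
    have 2: "inside K I'"
      using tmax_absorbs[OF v K(1) _ K(2) M(3) K(3) len] by blast
    have "run \<Delta> (linked E \<Delta> v w) K"
      using K(1) by (rule run_mono) (simp add: joint)
    from maximal_run_absorbs[OF lnk this 2 M(2) K(3) len] have "inside K J'" .
    then show ?thesis
      using 1 K(3) by (intro inside_antisym) (auto simp: meet_eq)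
  qed
  moreover have "?D \<subseteq> V"
    using tmaxD(1)[OF v] tmaxD(1)[OF w] by auto
  ultimately show ?thesis
    using M(4) by (simp add: tmax_def maximal_run_def)
qed

lemma extD:
  assumes "(w, J) \<in> ext C I"
  shows "w \<in> V" "w \<notin> C" "tmax (insert w C) J" "inside J I"
  using assms by (auto simp: ext_def)

lemma neighbor_exists:
  assumes "run \<Delta> (joint E \<Delta> D) K" "v \<in> D" "w \<in> D" "v \<noteq> w" "inside K I"
  shows "\<exists>J. (w, J) \<in> neighborhood E \<Delta> v I \<and> inside K J"
proof -
  have "run \<Delta> (linked E \<Delta> v w) K"
    using assms(1) by (rule run_mono) (use assms in \<open>simp add: joint_def\<close>)
  then show ?thesis
    using maximal_run_exists assms(5) unfolding neighborhood_iff by blast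
qed

text \<open>This preserves the invariant: if \<open>P\<close> and \<open>X\<close> together are the
  extensions of the current clique, their cuts are the extensions of the next one. One inclusion is
  \<open>meet_tmax\<close>. For the other, \<open>K\<close> is enlarged to a maximal interval
  \<open>J\<close> for \<open>insert w C\<close> and to a maximal contact interval
  \<open>J'\<close>; the meet of the two is time-maximal and contains \<open>K\<close>, hence equals
  it.\<close>

lemma cut_ext:
  assumes C: "tmax C I" and v: "(v, I') \<in> ext C I"
  shows "cut \<Delta> (ext C I) (neighborhood E \<Delta> v I') = ext (insert v C) I'"
proof (rule set_eqI, safe)
  fix w and K1 K2 :: int
  let ?K = "(K1, K2)"
  assume "(w, ?K) \<in> cut \<Delta> (ext C I) (neighborhood E \<Delta> v I')"
  then obtain J J' where J: "(w, J) \<in> ext C I" and J': "(w, J') \<in> neighborhood E \<Delta> v I'"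
    and K: "?K = meet J J'" "fst ?K + int \<Delta> \<le> snd ?K"
    unfolding cut_iff by blast
  have "tmax (insert w (insert v C)) ?K"
    using meet_tmax[OF extD(3)[OF v] extD(3)[OF J] J'] K by simp
  moreover have "inside ?K I'"
    using neighborhoodD(2)[OF J'] unfolding K(1) meet_eq by auto
  ultimately show "(w, ?K) \<in> ext (insert v C) I'"
    using extD(1,2)[OF J] neighborhoodD(4)[OF J'] by (auto simp: ext_def)
next
  fix w and K1 K2 :: int
  let ?K = "(K1, K2)"
  assume "(w, ?K) \<in> ext (insert v C) I'"
  note K = extD[OF this]
  note K' = tmaxD[OF K(3)]
  have "run \<Delta> (joint E \<Delta> (insert w C)) ?K"
    using K'(2) joint_mono by (blast intro: run_mono)
  then obtain J where J: "tmax (insert w C) J" "inside ?K J"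
    using tmax_exists[of "insert w C" ?K] K'(1,3) by auto
  have KI: "inside ?K I"
    using K(4) extD(4)[OF v] by auto
  \<comment> \<open>\<open>J\<close> and \<open>I\<close> share the window-long interval
    \<open>?K\<close>, so \<open>I\<close> absorbs \<open>J\<close>.\<close>
  have "inside J I"
    using tmax_absorbs[OF C tmaxD(2)[OF J(1)] _ tmaxD(3)[OF J(1)] KI J(2) K'(4)] by blast
  then have Jext: "(w, J) \<in> ext C I"
    using J(1) K(1,2) by (simp add: ext_def)
  obtain J' where J': "(w, J') \<in> neighborhood E \<Delta> v I'" "inside ?K J'"
    using neighbor_exists[OF K'(2), of v w I'] K(2,4) by auto
  have KM: "inside ?K (meet J J')"
    using J(2) J'(2) by (auto simp: meet_eq)
  then have len: "fst (meet J J') + int \<Delta> \<le> snd (meet J J')"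
    using K'(4) by auto
  have "?K = meet J J'"
    using tmax_unique[OF K(3) meet_tmax[OF extD(3)[OF v] J(1) J'(1) len], of ?K] KM K'(4)
    by simp
  then show "(w, ?K) \<in> cut \<Delta> (ext C I) (neighborhood E \<Delta> v I')"
    unfolding cut_iff using Jext J'(1) len by metis
qed

section \<open>Splitting the visited cliques along one iteration of the loop\<close>

lemma visited_empty: "visited {} C = {}"
  by (auto simp: visited_def)

text \<open>The first part consists of the cliques \<open>(D, K)\<close> with \<open>v\<close> in
  \<open>D\<close> and \<open>K\<close> inside \<open>I'\<close>; every other clique can do without
  the pair \<open>(v, I')\<close>. A clique in both parts would need a second pair
  \<open>(v, J)\<close> with \<open>K\<close> inside \<open>J\<close>, but then \<open>J\<close> and
  \<open>I'\<close> share a window and coincide.\<close>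

lemma visited_iterate:
  assumes P: "P \<subseteq> ext C I" and v: "(v, I') \<in> P"
  shows "visited P C = insert (insert v C, I')
      (visited (cut \<Delta> P (neighborhood E \<Delta> v I')) (insert v C)) \<union> visited (P - {(v, I')}) C"
    (is "_ = insert _ ?A \<union> ?B")
    and "(insert v C, I') \<notin> visited (cut \<Delta> P (neighborhood E \<Delta> v I')) (insert v C)"
    and "insert (insert v C, I') (visited (cut \<Delta> P (neighborhood E \<Delta> v I')) (insert v C))
      \<inter> visited (P - {(v, I')}) C = {}"
proof -
  have vext: "(v, I') \<in> ext C I"
    using P v by blast
  note v' = extD[OF vext]
  have A: "C \<subset> D" "tmax D K" "v \<in> D" "inside K I'" "\<forall>w\<in>D - C. \<exists>J. (w, J) \<in> P \<and> inside K J"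
    if DK: "(D, K) \<in> insert (insert v C, I') ?A" for D K
  proof -
    have "C \<subset> D \<and> tmax D K \<and> v \<in> D \<and> inside K I' \<and> (\<forall>w\<in>D - C. \<exists>J. (w, J) \<in> P \<and> inside K J)"
    proof (cases "(D, K) = (insert v C, I')")
      case True
      then have DK: "D = insert v C" "K = I'"
        by auto
      have "C \<subset> insert v C"
        using v'(2) by blast
      then show ?thesis
        unfolding DK using v' v by blast
    next
      case False
      then have D: "insert v C \<subset> D" "tmax D K"
        "\<forall>w\<in>D - insert v C. \<exists>J. (w, J) \<in> cut \<Delta> P (neighborhood E \<Delta> v I') \<and> inside K J"
        using DK by (auto simp: visited_def)
      have *: "inside K I' \<and> (\<exists>J. (w, J) \<in> P \<and> inside K J)" if w: "w \<in> D - insert v C" for w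
      proof -
        obtain M where "(w, M) \<in> cut \<Delta> P (neighborhood E \<Delta> v I')" "inside K M"
          using D(3) w by blast
        then obtain J J' where J: "(w, J) \<in> P" "(w, J') \<in> neighborhood E \<Delta> v I'"
          and KM: "inside K (meet J J')"
          unfolding cut_iff by blast
        then have "inside K J" "inside K I'"
          using neighborhoodD(2)[OF J(2)] by (auto simp: meet_eq)
        then show ?thesis
          using J(1) by blast
      qed
      obtain w where "w \<in> D - insert v C"
        using D(1) by blast
      then have KI: "inside K I'"
        using * by blast
      have "\<forall>w\<in>D - C. \<exists>J. (w, J) \<in> P \<and> inside K J"
        using * v KI by blast
      then show ?thesis
        using D KI v'(2) by auto
    qed
    then show "C \<subset> D" "tmax D K" "v \<in> D" "inside K I'"
      "\<forall>w\<in>D - C. \<exists>J. (w, J) \<in> P \<and> inside K J" by auto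
  qed
  \<comment> \<open>The converse of \<open>A\<close>: the properties \<open>v \<in> D\<close> and
    \<open>inside K I'\<close> single out the first part within \<open>visited P C\<close>.\<close>
  have B: "(D, K) \<in> insert (insert v C, I') ?A"
    if DK: "(D, K) \<in> visited P C" and vD: "v \<in> D" and KI: "inside K I'" for D K
  proof (cases "D = insert v C")
    case True
    have "tmax D K"
      using DK by (simp add: visited_def)
    then have "K = I'"
      using tmax_unique[of D K I' K] v'(3) True KI tmaxD(4)[of D K] by auto
    then show ?thesis
      using True by simp
  next
    case False
    have D: "C \<subset> D" "tmax D K" "\<forall>w\<in>D - C. \<exists>J. (w, J) \<in> P \<and> inside K J"
      using DK by (auto simp: visited_def)
    have "\<exists>M. (w, M) \<in> cut \<Delta> P (neighborhood E \<Delta> v I') \<and> inside K M"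
      if w: "w \<in> D - insert v C" for w
    proof -
      obtain J where J: "(w, J) \<in> P" "inside K J"
        using D(3) w by blast
      obtain J' where J': "(w, J') \<in> neighborhood E \<Delta> v I'" "inside K J'"
        using neighbor_exists[OF tmaxD(2)[OF D(2)] vD, of w I'] w KI by auto
      have "inside K (meet J J')"
        using J(2) J'(2) by (auto simp: meet_eq)
      moreover from this have "fst (meet J J') + int \<Delta> \<le> snd (meet J J')"
        using tmaxD(4)[OF D(2)] by auto
      ultimately show ?thesis
        unfolding cut_iff using J(1) J'(1) by blast
    qed
    then show ?thesis
      using D(1,2) vD False by (auto simp: visited_def)
  qed
  show "visited P C = insert (insert v C, I') ?A \<union> ?B"
  proof (rule subset_antisym; rule subrelI)
    fix D K
    assume DK: "(D, K) \<in> visited P C"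
    show "(D, K) \<in> insert (insert v C, I') ?A \<union> ?B"
    proof (rule ccontr)
      assume nin: "(D, K) \<notin> insert (insert v C, I') ?A \<union> ?B"
      have D: "C \<subset> D" "tmax D K" "\<forall>w\<in>D - C. \<exists>J. (w, J) \<in> P \<and> inside K J"
        using DK by (auto simp: visited_def)
      \<comment> \<open>If \<open>(v, I')\<close> cannot be spared, it is the only pair in
        \<open>P\<close> that serves some \<open>w\<close>; this forces \<open>w = v\<close> and
        \<open>K\<close> inside \<open>I'\<close>.\<close>
      obtain w where w: "w \<in> D - C" "\<not> (\<exists>J. (w, J) \<in> P - {(v, I')} \<and> inside K J)"
        using nin D(1,2) unfolding visited_def by blast
      then have "w = v" "inside K I'"
        using D(3) by blast+
      then show False
        using B[OF DK] w(1) nin by blast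
    qed
  next
    fix D K
    assume "(D, K) \<in> insert (insert v C, I') ?A \<union> ?B"
    then show "(D, K) \<in> visited P C"
    proof
      assume "(D, K) \<in> insert (insert v C, I') ?A"
      from A[OF this] show ?thesis
        by (simp add: visited_def)
    next
      assume "(D, K) \<in> ?B"
      then have "C \<subset> D" "tmax D K" "\<forall>w\<in>D - C. \<exists>J. (w, J) \<in> P - {(v, I')} \<and> inside K J"
        by (simp_all add: visited_def)
      moreover from this(3) have "\<forall>w\<in>D - C. \<exists>J. (w, J) \<in> P \<and> inside K J"
        by blast
      ultimately show ?thesis
        by (simp add: visited_def)
    qed
  qed
  show "(insert v C, I') \<notin> ?A"
    by (simp add: visited_def)
  have False if DK: "(D, K) \<in> insert (insert v C, I') ?A" "(D, K) \<in> ?B" for D K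
  proof -
    note a = A[OF DK(1)]
    have "\<forall>w\<in>D - C. \<exists>J. (w, J) \<in> P - {(v, I')} \<and> inside K J"
      using DK(2) by (simp add: visited_def)
    then obtain J where J: "(v, J) \<in> P" "J \<noteq> I'" "inside K J"
      using a(3) v'(2) by blast
    have "tmax (insert v C) J"
      using extD(3) J(1) P by blast
    then show False
      using tmax_unique[OF _ v'(3) J(3) a(4) tmaxD(4)[OF a(2)]] J(2) by blast
  qed
  then show "insert (insert v C, I') ?A \<inter> ?B = {}"
    by (metis disjoint_iff surj_pair)
qed

section \<open>Maximality and the test for reporting\<close>

lemma maximal_iff:
  "maximal_delta_clique V E T \<Delta> C I \<longleftrightarrow>
     tmax C I \<and> (\<forall>w\<in>V - C. \<not> run \<Delta> (joint E \<Delta> (insert w C)) I)"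
proof
  assume max: "maximal_delta_clique V E T \<Delta> C I"
  then have C: "C \<subseteq> V" "run \<Delta> (joint E \<Delta> C) I" "inside I T"
    by (auto simp: maximal_delta_clique_def delta_clique_iff)
  have "K = I" if K: "run \<Delta> (joint E \<Delta> C) K" "inside K T" "inside I K" for K
  proof (rule ccontr)
    assume "K \<noteq> I"
    then have "points I \<subset> points K"
      using points_psubset_iff[of I K] K(3) run_length[OF C(2)] run_length[OF K(1)] by auto
    moreover have "delta_clique V E T \<Delta> C K"
      using C(1) K by (simp add: delta_clique_iff)
    ultimately show False
      using max unfolding maximal_delta_clique_def time_maximal_def by blast
  qed
  then have "tmax C I"
    using C unfolding tmax_def maximal_run_def by blast
  moreover have "\<not> run \<Delta> (joint E \<Delta> (insert w C)) I" if w: "w \<in> V - C" for w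
  proof
    assume "run \<Delta> (joint E \<Delta> (insert w C)) I"
    then have "delta_clique V E T \<Delta> (insert w C) I"
      using C w by (simp add: delta_clique_iff)
    moreover have "C \<subset> insert w C"
      using w by blast
    ultimately show False
      using max unfolding maximal_delta_clique_def vertex_maximal_def by blast
  qed
  ultimately show "tmax C I \<and> (\<forall>w\<in>V - C. \<not> run \<Delta> (joint E \<Delta> (insert w C)) I)"
    by blast
next
  assume a: "tmax C I \<and> (\<forall>w\<in>V - C. \<not> run \<Delta> (joint E \<Delta> (insert w C)) I)"
  note C = tmaxD[OF a[THEN conjunct1]]
  have le: "fst I \<le> snd I"
    using C(4) by linarith
  \<comment> \<open>A larger clique on a larger interval restricts to \<open>I\<close> and to a
    single additional vertex, so testing single vertices on \<open>I\<close> suffices.\<close>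
  have False if D: "delta_clique V E T \<Delta> D K" "points I \<subseteq> points K" "C \<subset> D" for D K
  proof -
    have K: "D \<subseteq> V" "run \<Delta> (joint E \<Delta> D) K"
      using D(1) by (auto simp: delta_clique_iff)
    obtain w where w: "w \<in> D" "w \<notin> C"
      using D(3) by blast
    have "run \<Delta> (joint E \<Delta> (insert w C)) K"
      using K(2) by (rule run_mono) (use D(3) w joint_mono in blast)
    then have "run \<Delta> (joint E \<Delta> (insert w C)) I"
      using run_inside D(2) C(4) by (metis le points_subset_iff)
    then show False
      using a w K(1) by blast
  qed
  moreover have False if D: "delta_clique V E T \<Delta> D K" "points I \<subset> points K" "C \<subseteq> D" for D K
  proof -
    have K: "run \<Delta> (joint E \<Delta> D) K" "inside K T"
      using D(1) by (auto simp: delta_clique_iff)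
    have "run \<Delta> (joint E \<Delta> C) K"
      using K(1) by (rule run_mono) (use D(3) joint_mono in blast)
    moreover have "inside I K" "K \<noteq> I"
      using D(2) points_subset_iff[OF le, of K] by auto
    ultimately show False
      using a K(2) unfolding tmax_def maximal_run_def by blast
  qed
  ultimately show "maximal_delta_clique V E T \<Delta> C I"
    using C unfolding maximal_delta_clique_def vertex_maximal_def time_maximal_def delta_clique_iff
    by blast
qed

text \<open>All intervals in \<open>ext C I\<close> lie inside \<open>I\<close>, so the test fails
  exactly when some pair \<open>(w, I)\<close> occurs. If \<open>insert w C\<close> is a clique on
  \<open>I\<close>, then it is automatically time-maximal there, because \<open>I\<close> already
  cannot be extended for \<open>C\<close>.\<close>

lemma reportable_iff:
  assumes C: "tmax C I" and PX: "P \<union> X = ext C I"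
  shows "reportable P I X \<longleftrightarrow> maximal_delta_clique V E T \<Delta> C I"
proof -
  have I: "fst I \<le> snd I"
    using tmaxD(4)[OF C] by linarith
  have *: "points J \<subset> points I \<longleftrightarrow> J \<noteq> I" if "(w, J) \<in> ext C I" for w J
    using points_psubset_iff[of J I] extD[OF that] tmaxD(4) I by fastforce
  have "reportable P I X \<longleftrightarrow> (\<forall>w J. (w, J) \<in> ext C I \<longrightarrow> points J \<subset> points I)"
    unfolding reportable_def PX by blast
  also have "\<dots> \<longleftrightarrow> (\<forall>w. (w, I) \<notin> ext C I)"
    using * by blast
  finally have "reportable P I X \<longleftrightarrow> (\<forall>w. (w, I) \<notin> ext C I)" .
  moreover have "(w, I) \<in> ext C I \<longleftrightarrow> w \<in> V - C \<and> run \<Delta> (joint E \<Delta> (insert w C)) I" for w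
  proof -
    have "K = I" if K: "run \<Delta> (joint E \<Delta> (insert w C)) K" "inside K T" "inside I K" for K
    proof -
      have "run \<Delta> (joint E \<Delta> C) K"
        using K(1) by (rule run_mono) (use joint_mono in blast)
      then show ?thesis
        using C K unfolding tmax_def maximal_run_def by blast
    qed
    then show ?thesis
      using tmaxD[OF C] by (auto simp: ext_def tmax_def maximal_run_def)
  qed
  ultimately show ?thesis
    using C by (auto simp: maximal_iff)
qed

section \<open>Costs\<close>

text \<open>The number of time labels, one more than \<open>duration T\<close>; it bounds the number
  of possible starts of windows.\<close>

definition windows :: nat where
  "windows = nat (snd T - fst T + 1)"

text \<open>Each \<open>w\<close> owns a time-edge with vertex set \<open>{v, w}\<close>, and
  distinct \<open>w\<close> own distinct ones.\<close>

lemma card_linked_le: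
  assumes "\<And>w. w \<in> W \<Longrightarrow> \<exists>\<tau>. linked E \<Delta> v w \<tau>"
  shows "finite W" "card W \<le> card E"
proof -
  show fin: "finite W"
    by (rule finite_subset[OF _ finite_V]) (use assms linkedD in blast)
  show "card W \<le> card E"
  proof (rule card_le_if_inj_on_rel[of E W "\<lambda>w et. fst et = {v, w}"])
    fix w assume "w \<in> W"
    then obtain \<tau> where "linked E \<Delta> v w \<tau>"
      using assms by blast
    then show "\<exists>et. et \<in> E \<and> fst et = {v, w}"
      unfolding linked_def slice_edges_def by force
  qed (use finite_E in \<open>auto simp: doubleton_eq_iff\<close>)
qed

lemma card_tmax_le:
  assumes "tmax D K"
  shows "card D \<le> 1 + card E"
proof (cases "D = {}")
  case False
  then obtain v where v: "v \<in> D"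
    by blast
  have "finite D"
    using tmaxD(1)[OF assms] finite_V finite_subset by blast
  moreover have "card (D - {v}) \<le> card E"
  proof (rule card_linked_le(2)[of _ v])
    fix w assume "w \<in> D - {v}"
    then show "\<exists>\<tau>. linked E \<Delta> v w \<tau>"
      using run_first[OF tmaxD(2)[OF assms]] v unfolding joint_def by (intro exI[of _ "fst K"]) auto
  qed
  ultimately show ?thesis
    using v by simp
qed simp

text \<open>If \<open>J\<close> does not start together with \<open>I\<close>, some vertex of \<open>C\<close> loses contact to \<open>w\<close> in the
  window before \<open>J\<close>, so the first window of \<open>J\<close> ends with a time-edge between the two.\<close>

lemma card_ext_late:
  assumes C: "tmax C I"
  shows "card {(w, J) \<in> ext C I. fst J \<noteq> fst I} \<le> card E"
\<comment> \<open>A relation replaces a function, as several vertices of \<open>C\<close> may lose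
  contact to \<open>w\<close> at once. Whichever edge is taken, \<open>e - C\<close> recovers
  \<open>w\<close> and \<open>t\<close> recovers the start of \<open>J\<close>.\<close>
proof (rule card_le_if_inj_on_rel[of E _ "\<lambda>(w, J) (e, t). e - C = {w} \<and> t = fst J + int \<Delta>"])
  show "finite E"
    by (rule finite_E)
next
  fix x assume x: "x \<in> {(w, J) \<in> ext C I. fst J \<noteq> fst I}"
  obtain w J where wJ: "x = (w, J)" "(w, J) \<in> ext C I" "fst J \<noteq> fst I"
    using x by blast
  note J = extD[OF wJ(2)]
  have ne: "fst J \<noteq> fst T"
    using J(4) wJ(3) tmaxD(3)[OF C] by auto
  then have "\<not> joint E \<Delta> (insert w C) (fst J - 1)"
    using J(3) maximal_run_start unfolding tmax_def by blast
  \<comment> \<open>\<open>J\<close> starts strictly after \<open>I\<close>, so the preceding window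
    still lies in \<open>I\<close>, and the failure there must involve \<open>w\<close>.\<close>
  moreover have "joint E \<Delta> C (fst J - 1)"
    using tmaxD(2)[OF C] J(4) wJ(3) tmaxD(4)[OF J(3)] by (auto simp: run_def)
  ultimately obtain u where u: "u \<in> C" "u \<noteq> w" "\<not> linked E \<Delta> u w (fst J - 1)"
    by (auto simp: joint_insert)
  have "linked E \<Delta> u w (fst J)"
    using run_first[OF tmaxD(2)[OF J(3)]] u by (auto simp: joint_insert)
  then have "({u, w}, fst J + int \<Delta>) \<in> E"
    using u(3) by (rule linked_start)
  moreover have "{u, w} - C = {w}"
    using u(1) J(2) by blast
  ultimately show "\<exists>b. b \<in> E \<and> (case x of (w, J) \<Rightarrow> \<lambda>(e, t). e - C = {w} \<and> t = fst J + int \<Delta>) b"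
    unfolding wJ(1) by (intro exI[of _ "({u, w}, fst J + int \<Delta>)"]) simp
next
  fix x y b
  assume x: "x \<in> {(w, J) \<in> ext C I. fst J \<noteq> fst I}" and y: "y \<in> {(w, J) \<in> ext C I. fst J \<noteq> fst I}"
    and r: "(case x of (w, J) \<Rightarrow> \<lambda>(e, t). e - C = {w} \<and> t = fst J + int \<Delta>) b"
      "(case y of (w, J) \<Rightarrow> \<lambda>(e, t). e - C = {w} \<and> t = fst J + int \<Delta>) b"
  obtain w J where x: "x = (w, J)" "(w, J) \<in> ext C I"
    using x by blast
  obtain w' J' where y: "y = (w', J')" "(w', J') \<in> ext C I"
    using y by blast
  have "w' = w" "fst J = fst J'"
    using r unfolding x(1) y(1) by (auto split: prod.splits)
  then show "x = y"
    using tmax_unique_start[OF extD(3)[OF x(2)], of J'] extD(3)[OF y(2)] x(1) y(1) by simp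
qed

text \<open>Pairs that start together with \<open>I\<close> are determined by their vertex; all
  others are counted by \<open>card_ext_late\<close>.\<close>

lemma card_ext_restrict:
  assumes C: "tmax C I" and W: "finite W"
  shows "card {(w, J) \<in> ext C I. w \<in> W} \<le> card W + card E"
proof -
  let ?early = "{(w, J) \<in> ext C I. w \<in> W \<and> fst J = fst I}"
  let ?late = "{(w, J) \<in> ext C I. fst J \<noteq> fst I}"
  have fin: "finite ?late" "finite ?early"
    by (rule finite_subset[OF _ finite_ext[of C I]], blast)+
  have "inj_on fst ?early"
  proof (rule inj_onI)
    fix x y assume xy: "x \<in> ?early" "y \<in> ?early" "fst x = fst y"
    obtain w J where x: "x = (w, J)"
      by (cases x)
    obtain J' where y: "y = (w, J')"
      using xy(3) x by (cases y) simp
    show "x = y"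
      using xy tmax_unique_start[of "insert w C" J J'] unfolding x y by (simp add: ext_def)
  qed
  moreover have "fst ` ?early \<subseteq> W"
    by auto
  ultimately have "card ?early \<le> card W"
    using W by (rule card_inj_on_le)
  moreover have "card {(w, J) \<in> ext C I. w \<in> W} \<le> card (?early \<union> ?late)"
    using fin by (intro card_mono) auto
  ultimately show ?thesis
    using card_ext_late[OF C] card_Un_le[of ?early ?late] by linarith
qed

text \<open>Every extending vertex is linked to one fixed vertex of \<open>D\<close>, which leaves
  at most \<open>card E\<close> such vertices.\<close>

lemma card_ext_le:
  assumes D: "tmax D K" "D \<noteq> {}"
  shows "card (ext D K) \<le> 2 * card E"
proof -
  obtain v where v: "v \<in> D"
    using D(2) by blast
  have "\<exists>\<tau>. linked E \<Delta> v w \<tau>" if w: "w \<in> fst ` ext D K" for w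
  proof -
    obtain x where "x \<in> ext D K" "w = fst x"
      using w by blast
    then have "(w, snd x) \<in> ext D K"
      by simp
    then obtain J where J: "(w, J) \<in> ext D K"
      by blast
    then show ?thesis
      using run_first[OF tmaxD(2)[OF extD(3)[OF J]]] extD(2)[OF J] v
      by (intro exI[of _ "fst J"]) (auto simp: joint_insert)
  qed
  from card_linked_le[OF this] have W: "finite (fst ` ext D K)" "card (fst ` ext D K) \<le> card E"
    by auto
  have "{(w, J) \<in> ext D K. w \<in> fst ` ext D K} = ext D K"
    by force
  then show ?thesis
    using card_ext_restrict[OF D(1) W(1)] W(2) by simp
qed

text \<open>The intervals of one vertex have different starts, all of them in
  \<open>T\<close>.\<close>

lemma card_bucket_le:
  assumes "P \<subseteq> ext C I"
  shows "card {J. (w, J) \<in> P} \<le> windows"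
proof -
  have "card {J. (w, J) \<in> P} \<le> card {fst T..snd T}"
  proof (rule card_inj_on_le[of fst])
    show "inj_on fst {J. (w, J) \<in> P}"
      using assms extD(3) tmax_unique_start by (intro inj_onI) blast
    show "fst ` {J. (w, J) \<in> P} \<subseteq> {fst T..snd T}"
    proof
      fix a assume "a \<in> fst ` {J. (w, J) \<in> P}"
      then obtain J where J: "a = fst J" "(w, J) \<in> ext C I"
        using assms by blast
      then show "a \<in> {fst T..snd T}"
        using tmaxD[OF extD(3)[OF J(2)]] by simp
    qed
  qed simp
  then show ?thesis
    by (simp add: windows_def)
qed

section \<open>Late and early neighbours, and the cost of one iteration\<close>

definition late :: "'v \<Rightarrow> interval \<Rightarrow> 'v vertex_interval set" where
  "late v K = {(w, J) \<in> neighborhood E \<Delta> v K. fst J \<noteq> fst K}"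

definition early :: "'v \<Rightarrow> interval \<Rightarrow> 'v vertex_interval set" where
  "early v K = {(w, J) \<in> neighborhood E \<Delta> v K. fst J = fst K}"

lemma neighborhood_split:
  "neighborhood E \<Delta> v K = early v K \<union> late v K" "early v K \<inter> late v K = {}"
  "finite (early v K)" "finite (late v K)"
  using finite_subset[OF _ finite_neighborhood[of v K], of "early v K"]
    finite_subset[OF _ finite_neighborhood[of v K], of "late v K"]
  by (auto simp: early_def late_def)

lemma lateD:
  assumes "(w, J) \<in> late v K"
  shows "({v, w}, fst J + int \<Delta>) \<in> E" "inside J K" "fst J + int \<Delta> \<le> snd J"
proof -
  have J: "(w, J) \<in> neighborhood E \<Delta> v K" "fst J \<noteq> fst K"
    using assms by (auto simp: late_def)
  have "\<not> linked E \<Delta> v w (fst J - 1)"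
    using J by (intro maximal_run_start) (auto simp: neighborhood_iff)
  then show "({v, w}, fst J + int \<Delta>) \<in> E"
    by (rule linked_start[OF neighborhoodD(1)[OF J(1)]])
  show "inside J K" "fst J + int \<Delta> \<le> snd J"
    using neighborhoodD(2,3)[OF J(1)] by simp_all
qed

lemma late_unique:
  assumes "(w, J) \<in> late v K" "(w, J') \<in> late v K" "fst J = fst J'"
  shows "J = J'"
  using assms maximal_run_unique_start[of \<Delta> "linked E \<Delta> v w" K J J']
  by (simp add: late_def neighborhood_iff)

text \<open>The time-edge that ends the first window of \<open>J\<close> reveals \<open>w\<close>
  and the start of \<open>J\<close>, hence \<open>J\<close> itself.\<close>

lemma card_late_le: "card (late v K) \<le> card E"
proof (rule card_inj_on_le[of "\<lambda>(w, J). ({v, w}, fst J + int \<Delta>)"])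
  show "inj_on (\<lambda>(w, J). ({v, w}, fst J + int \<Delta>)) (late v K)"
  proof (rule inj_onI)
    fix x y assume xy: "x \<in> late v K" "y \<in> late v K"
      "(case x of (w, J) \<Rightarrow> ({v, w}, fst J + int \<Delta>)) = (case y of (w, J) \<Rightarrow> ({v, w}, fst J + int \<Delta>))"
    obtain w J w' J' where eq: "x = (w, J)" "y = (w', J')"
      by (meson surj_pair)
    have "w = w'" "fst J = fst J'"
      using xy(3) unfolding eq by (auto simp: doubleton_eq_iff)
    then show "x = y"
      using late_unique[of w J v K J'] xy(1,2) unfolding eq by simp
  qed
  show "(\<lambda>(w, J). ({v, w}, fst J + int \<Delta>)) ` late v K \<subseteq> E"
  proof clarify
    fix w J assume "(w, J) \<in> late v K"
    then show "({v, w}, fst J + int \<Delta>) \<in> E"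
      by (rule lateD(1))
  qed
qed (rule finite_E)

lemma early_neighbors:
  "inj_on fst (early v K)" "finite (fst ` early v K)" "card (fst ` early v K) \<le> card E"
proof -
  show "inj_on fst (early v K)"
    by (rule inj_onI)
      (auto simp: early_def neighborhood_iff dest: maximal_run_unique_start)
  have "\<exists>\<tau>. linked E \<Delta> v w \<tau>" if "w \<in> fst ` early v K" for w
    using that neighborhoodD(1) by (fastforce simp: early_def)
  from card_linked_le[OF this]
  show "finite (fst ` early v K)" "card (fst ` early v K) \<le> card E"
    by auto
qed

lemma card_neighborhood_le: "card (neighborhood E \<Delta> v K) \<le> 2 * card E"
  using card_late_le[of v K] early_neighbors[of v K] card_image[of fst "early v K"]
    neighborhood_split[of v K] card_Un_disjoint[of "early v K" "late v K"] by simp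

text \<open>Early neighbours have distinct vertices, so the buckets they meet are disjoint and hold
  at most \<open>2 * card E\<close> pairs in total. Late neighbours may meet the same bucket
  repeatedly, so each is charged a full bucket. The other \<open>2 * card E\<close> pays for the
  size of the neighborhood.\<close>

lemma cut_cost_le:
  assumes C: "tmax C I" and P: "P \<subseteq> ext C I"
  shows "cut_cost P (neighborhood E \<Delta> v K) \<le> 1 + 4 * card E + windows * card (late v K)"
proof -
  let ?N = "neighborhood E \<Delta> v K"
  let ?g = "\<lambda>w. card {J. (w, J) \<in> P}"
  have finP: "finite P"
    using P finite_ext finite_subset by blast
  have finb: "finite {J. (w, J) \<in> P}" for w
    by (rule finite_subset[of _ "snd ` P"]) (use finP in force)+
  have "(\<Sum>x\<in>early v K. ?g (fst x)) = (\<Sum>w\<in>fst ` early v K. ?g w)"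
    using early_neighbors(1) by (simp add: sum.reindex)
  also have "\<dots> = card (SIGMA w:fst ` early v K. {J. (w, J) \<in> P})"
    using early_neighbors(2) finb by simp
  also have "\<dots> \<le> card {(w, J) \<in> ext C I. w \<in> fst ` early v K}"
  proof (rule card_mono)
    show "finite {(w, J) \<in> ext C I. w \<in> fst ` early v K}"
      by (rule finite_subset[OF _ finite_ext[of C I]]) blast
    show "(SIGMA w:fst ` early v K. {J. (w, J) \<in> P}) \<subseteq> {(w, J) \<in> ext C I. w \<in> fst ` early v K}"
      using P by blast
  qed
  also have "\<dots> \<le> 2 * card E"
    using card_ext_restrict[OF C early_neighbors(2)[of v K]] early_neighbors(3)[of v K] by linarith
  finally have 1: "(\<Sum>x\<in>early v K. ?g (fst x)) \<le> 2 * card E" .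
  have 2: "(\<Sum>x\<in>late v K. ?g (fst x)) \<le> windows * card (late v K)"
    using sum_bounded_above[of "late v K" "\<lambda>x. ?g (fst x)" windows] card_bucket_le[OF P]
    by (simp add: mult.commute)
  have "cut_cost P ?N = 1 + card ?N + (\<Sum>x\<in>?N. ?g (fst x))"
    unfolding cut_cost_def by (simp add: case_prod_beta sum_Suc)
  also have "(\<Sum>x\<in>?N. ?g (fst x)) = (\<Sum>x\<in>early v K. ?g (fst x)) + (\<Sum>x\<in>late v K. ?g (fst x))"
    using neighborhood_split[of v K] by (simp add: sum.union_disjoint)
  finally show ?thesis
    using 1 2 card_neighborhood_le[of v K] by linarith
qed

text \<open>The cost comes from the last vertex added, but the sum runs over all vertices of the
  clique so that the charge depends only on the clique, not on the order of insertion. The factor 2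
  stands for the two cuts, of \<open>P\<close> and of \<open>X\<close>; 17 is the total coefficient
  of \<open>card E\<close> in one iteration and exceeds the constant term 10.\<close>

definition charge :: "'v set \<times> interval \<Rightarrow> nat" where
  "charge x = 17 * (1 + card E) + 2 * windows * (\<Sum>v\<in>fst x. card (late v (snd x)))"

text \<open>An iteration is charged together with the fixed part of the call it makes: the test, a
  possible report, and the final \<open>1\<close> that ends the inner loop.\<close>

lemma iteration_cost_le:
  assumes C: "tmax C I" and P: "P \<subseteq> ext C I" and X: "X \<subseteq> ext C I" and v: "(v, I') \<in> ext C I"
  defines "N \<equiv> neighborhood E \<Delta> v I'"
  shows "1 + copy_cost C + neighborhood_cost E \<Delta> v I' + cut_cost P N + cut_cost X N
    + test_cost (cut \<Delta> P N) (cut \<Delta> X N) + copy_cost (insert v C) + 1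
    \<le> charge (insert v C, I')"
proof -
  note v' = extD[OF v]
  have "card (cut \<Delta> Y N) \<le> 2 * card E" if "Y \<subseteq> ext C I" for Y
  proof -
    have "cut \<Delta> Y N \<subseteq> ext (insert v C) I'"
      using cut_mono[OF that, of \<Delta> N] cut_ext[OF C v] unfolding N_def by simp
    then have "card (cut \<Delta> Y N) \<le> card (ext (insert v C) I')"
      by (rule card_mono[OF finite_ext])
    then show ?thesis
      using card_ext_le[OF v'(3)] by simp
  qed
  from this[OF P] this[OF X] have test: "test_cost (cut \<Delta> P N) (cut \<Delta> X N) \<le> 1 + 4 * card E"
    by (simp add: test_cost_def)
  have "finite (insert v C)"
    using tmaxD(1)[OF v'(3)] finite_V by (rule finite_subset)
  then have "card (late v I') \<le> (\<Sum>u\<in>insert v C. card (late u I'))"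
    by (intro member_le_sum) auto
  then have le: "2 * windows * card (late v I') \<le> 2 * windows * (\<Sum>u\<in>insert v C. card (late u I'))"
    by (rule mult_left_mono) simp
  define q where "q = windows * card (late v I')"
  have "17 + 17 * card E + 2 * q \<le> charge (insert v C, I')"
    using le by (simp add: charge_def q_def mult.assoc)
  moreover have "neighborhood_cost E \<Delta> v I' \<le> 1 + 3 * card E"
    using card_neighborhood_le[of v I'] by (simp add: neighborhood_cost_def)
  moreover have "copy_cost C \<le> 2 + card E" "copy_cost (insert v C) \<le> 2 + card E"
    using card_tmax_le[OF C] card_tmax_le[OF v'(3)] by (simp_all add: copy_cost_def)
  ultimately show ?thesis
    using test cut_cost_le[OF C P, of v I', folded q_def] cut_cost_le[OF C X, of v I', folded q_def]
    unfolding N_def by linarith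
qed

section \<open>Executions\<close>

text \<open>The measure is lexicographic. A recursive call loses the vertex \<open>v\<close>, which
  is not its own neighbour; the rest of the loop gains no vertices and has one pair fewer.\<close>

lemma terminates:
  assumes ord: "valid_order pick" and P: "finite P"
  shows "\<exists>out n. bk_loop E \<Delta> pick P (C, I) X out n"
  using P
proof (induction P arbitrary: C I X
    rule: wf_induct_rule[OF wf_measures[of "[\<lambda>P. card (fst ` P), card]"], case_names less])
  case (less P)
  show ?case
  proof (cases "P = {}")
    case True
    then show ?thesis
      using bk_call_bk_loop.finish by blast
  next
    case False
    obtain v I' where pick: "pick P (C, I) X = (v, I')"
      by (cases "pick P (C, I) X")
    have vP: "(v, I') \<in> P"
      using ord False pick unfolding valid_order_def by metis
    define N where "N = neighborhood E \<Delta> v I'"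
    have "cut \<Delta> P N \<subseteq> (\<lambda>(x, y). (fst x, meet (snd x) (snd y))) ` (P \<times> N)"
      unfolding cut_def by force
    then have fin: "finite (cut \<Delta> P N)"
      using less(2) finite_neighborhood unfolding N_def
      by (meson finite_SigmaI finite_imageI finite_subset)
    have "fst ` cut \<Delta> P N \<subseteq> fst ` P - {v}"
    proof
      fix w assume "w \<in> fst ` cut \<Delta> P N"
      then obtain K where "(w, K) \<in> cut \<Delta> P N"
        by force
      then obtain I J where "(w, I) \<in> P" "(w, J) \<in> N"
        unfolding cut_iff by blast
      then show "w \<in> fst ` P - {v}"
        using neighborhoodD(4)[of w J v I'] imageI[of "(w, I)" P fst] unfolding N_def by simp
    qed
    moreover have "v \<in> fst ` P"
      using imageI[OF vP, of fst] by simp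
    ultimately have "fst ` cut \<Delta> P N \<subset> fst ` P"
      by blast
    then have "card (fst ` cut \<Delta> P N) < card (fst ` P)"
      using less(2) by (intro psubset_card_mono) auto
    then have "\<exists>out n. bk_loop E \<Delta> pick (cut \<Delta> P N) (insert v C, I') (cut \<Delta> X N) out n"
      using fin by (intro less(1)) simp_all
    then obtain out1 n1 where
      1: "bk_loop E \<Delta> pick (cut \<Delta> P N) (insert v C, I') (cut \<Delta> X N) out1 n1"
      by blast
    then obtain out1' n1' where
      1: "bk_call E \<Delta> pick (cut \<Delta> P N) (insert v C, I') (cut \<Delta> X N) out1' n1'"
      using bk_call_bk_loop.report[OF _ 1] bk_call_bk_loop.no_report[OF _ 1] by blast
    have "card (fst ` (P - {(v, I')})) \<le> card (fst ` P)"
      using less(2) by (intro card_mono) auto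
    moreover have "card (P - {(v, I')}) < card P"
      using vP less(2) by (meson card_Diff1_less)
    ultimately have "\<exists>out n. bk_loop E \<Delta> pick (P - {(v, I')}) (C, I) (insert (v, I') X) out n"
      using less(2) by (intro less(1)) auto
    then show ?thesis
      using bk_call_bk_loop.iterate[OF False pick N_def 1] by blast
  qed
qed

text \<open>A mutual induction in which a call accounts for its own clique \<open>R\<close> and the
  loop for the cliques below it. \<open>visited_iterate\<close> gives both that nothing is reported
  twice and that each visited clique is charged once.\<close>

lemma execution:
  assumes ord: "valid_order pick"
  shows "bk_call E \<Delta> pick P R X out n \<Longrightarrow> tmax (fst R) (snd R) \<Longrightarrow> P \<union> X = ext (fst R) (snd R) \<Longrightarrow>
      distinct out \<and>
      set out = {x \<in> insert R (visited P (fst R)). maximal_delta_clique V E T \<Delta> (fst x) (snd x)} \<and>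
      n \<le> test_cost P X + copy_cost (fst R) + 1 + sum charge (visited P (fst R))"
    and "bk_loop E \<Delta> pick P R X out n \<Longrightarrow> tmax (fst R) (snd R) \<Longrightarrow> P \<union> X = ext (fst R) (snd R) \<Longrightarrow>
      distinct out \<and>
      set out = {x \<in> visited P (fst R). maximal_delta_clique V E T \<Delta> (fst x) (snd x)} \<and>
      n \<le> 1 + sum charge (visited P (fst R))"
proof (induction rule: bk_call_bk_loop.inducts)
  case (report P I X C out n)
  then have IH: "distinct out"
    "set out = {x \<in> visited P C. maximal_delta_clique V E T \<Delta> (fst x) (snd x)}"
    "n \<le> 1 + sum charge (visited P C)"
    by simp_all
  have "maximal_delta_clique V E T \<Delta> C I"
    using reportable_iff[of C I P X] report by simp
  then have "set ((C, I) # out) =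
      {x \<in> insert (C, I) (visited P C). maximal_delta_clique V E T \<Delta> (fst x) (snd x)}"
    unfolding list.set IH(2)
    by (intro set_eqI) (metis (mono_tags, lifting) fst_conv insert_iff mem_Collect_eq snd_conv)
  moreover have "distinct ((C, I) # out)"
    using IH(1,2) by (simp add: visited_def)
  ultimately show ?case
    using IH(3) by simp
next
  case (no_report P I X C out n)
  then have IH: "distinct out"
    "set out = {x \<in> visited P C. maximal_delta_clique V E T \<Delta> (fst x) (snd x)}"
    "n \<le> 1 + sum charge (visited P C)"
    by simp_all
  have "\<not> maximal_delta_clique V E T \<Delta> C I"
    using reportable_iff[of C I P X] no_report by simp
  then have "set out =
      {x \<in> insert (C, I) (visited P C). maximal_delta_clique V E T \<Delta> (fst x) (snd x)}"
    unfolding IH(2)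
    by (intro set_eqI) (metis (mono_tags, lifting) fst_conv insert_iff mem_Collect_eq snd_conv)
  then show ?case
    using IH(1,3) by simp
next
  case (finish C I X)
  then show ?case
    by (simp add: visited_empty)
next
  case (iterate P C I X v I' N out1 n1 out2 n2)
  have C: "tmax C I" and PX: "P \<union> X = ext C I"
    using iterate.prems by simp_all
  have v: "(v, I') \<in> P"
    using ord iterate(1,2) unfolding valid_order_def by metis
  have vext: "(v, I') \<in> ext C I" and P: "P \<subseteq> ext C I" and X: "X \<subseteq> ext C I"
    using v PX by blast+
  let ?A = "visited (cut \<Delta> P N) (insert v C)" and ?B = "visited (P - {(v, I')}) C"
  have "cut \<Delta> P N \<union> cut \<Delta> X N = ext (insert v C) I'"
    using cut_ext[OF C vext] PX iterate(3) by (simp add: cut_Un[symmetric])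
  then have IH1: "distinct out1"
    "set out1 = {x \<in> insert (insert v C, I') ?A. maximal_delta_clique V E T \<Delta> (fst x) (snd x)}"
    "n1 \<le> test_cost (cut \<Delta> P N) (cut \<Delta> X N) + copy_cost (insert v C) + 1 + sum charge ?A"
    using iterate(5) extD(3)[OF vext] by simp_all
  have "P - {(v, I')} \<union> insert (v, I') X = ext C I"
    using PX v by blast
  then have IH2: "distinct out2"
    "set out2 = {x \<in> ?B. maximal_delta_clique V E T \<Delta> (fst x) (snd x)}"
    "n2 \<le> 1 + sum charge ?B"
    using iterate(7) C by simp_all
  note vis = visited_iterate[OF P v, folded iterate(3)]
  have "set (out1 @ out2) = {x \<in> visited P C. maximal_delta_clique V E T \<Delta> (fst x) (snd x)}"
    unfolding vis(1) set_append IH1(2) IH2(2) by blast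
  moreover have "distinct (out1 @ out2)"
    unfolding distinct_append using IH1(1,2) IH2(1,2) vis(3) by blast
  moreover have "sum charge (visited P C) = charge (insert v C, I') + sum charge ?A + sum charge ?B"
  proof -
    have "sum charge (visited P C) = sum charge (insert (insert v C, I') ?A) + sum charge ?B"
      unfolding vis(1) using finite_visited vis(3) by (intro sum.union_disjoint) auto
    then show ?thesis
      using vis(2) finite_visited by simp
  qed
  ultimately show ?case
    using IH1(3) IH2(3) iteration_cost_le[OF C P X vext, folded iterate(3)] by simp
qed

section \<open>The total cost\<close>

lemma finite_slice_edges: "finite (slice_edges E \<Delta> t)"
  by (rule finite_subset[of _ "fst ` E"]) (use finite_E in \<open>force simp: slice_edges_def\<close>)+

lemma card_slice_cliques_le:
  assumes "has_slice_degeneracy V E T \<Delta> d" "t \<in> points T"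
  shows "card (static_cliques V (slice_edges E \<Delta> t)) \<le> card V * 2 ^ d"
  using card_static_cliques_le[OF finite_slice_edges] assms finite_V
  unfolding has_slice_degeneracy_def by blast

lemma tmax_static_clique:
  assumes D: "tmax D K" "D \<noteq> {}" and t: "fst K \<le> t" "t + int \<Delta> \<le> snd K"
  shows "D \<in> static_cliques V (slice_edges E \<Delta> t)"
proof -
  have "joint E \<Delta> D t"
    using tmaxD(2)[OF D(1)] t by (simp add: run_def)
  then show ?thesis
    using tmaxD(1)[OF D(1)] D(2) by (simp add: static_cliques_def joint_def linked_def)
qed

definition tmax_cliques :: "('v set \<times> interval) set" where
  "tmax_cliques = {(D, K). tmax D K \<and> D \<noteq> {}}"

lemma finite_tmax_cliques: "finite tmax_cliques"
  by (rule finite_subset[OF _ finite_tmax]) (auto simp: tmax_cliques_def)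

lemma card_tmax_cliques_le:
  assumes deg: "has_slice_degeneracy V E T \<Delta> d"
  shows "card tmax_cliques \<le> windows * (card V * 2 ^ d)"
proof -
  let ?B = "SIGMA t:{fst T..snd T}. static_cliques V (slice_edges E \<Delta> t)"
  have fin: "finite ?B"
    using finite_static_cliques[OF finite_V] by blast
  have "card tmax_cliques \<le> card ?B"
  proof (rule card_inj_on_le[of "\<lambda>(D, K). (fst K, D)"])
    show "inj_on (\<lambda>(D, K). (fst K, D)) tmax_cliques"
    proof (rule inj_onI)
      fix x y assume xy: "x \<in> tmax_cliques" "y \<in> tmax_cliques"
        "(case x of (D, K) \<Rightarrow> (fst K, D)) = (case y of (D, K) \<Rightarrow> (fst K, D))"
      obtain D K D' K' where eq: "x = (D, K)" "y = (D', K')"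
        by (meson surj_pair)
      show "x = y"
        using xy tmax_unique_start[of D K K'] unfolding eq tmax_cliques_def by simp
    qed
    show "(\<lambda>(D, K). (fst K, D)) ` tmax_cliques \<subseteq> ?B"
    proof clarify
      fix D K assume "(D, K) \<in> tmax_cliques"
      then have D: "tmax D K" "D \<noteq> {}"
        by (auto simp: tmax_cliques_def)
      show "fst K \<in> {fst T..snd T} \<and> D \<in> static_cliques V (slice_edges E \<Delta> (fst K))"
        using tmax_static_clique[OF D, of "fst K"] tmaxD(3,4)[OF D(1)] by simp
    qed
  qed (rule fin)
  also have "\<dots> = (\<Sum>t\<in>{fst T..snd T}. card (static_cliques V (slice_edges E \<Delta> t)))"
    using finite_static_cliques[OF finite_V] by simp
  also have "\<dots> \<le> (\<Sum>t\<in>{fst T..snd T}. card V * 2 ^ d)"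
    by (rule sum_mono) (use card_slice_cliques_le[OF deg] in \<open>simp add: points_eq\<close>)
  also have "\<dots> = windows * (card V * 2 ^ d)"
    by (simp add: windows_def)
  finally show ?thesis .
qed

text \<open>A late neighbour \<open>(w, J)\<close> of \<open>v\<close> in \<open>K\<close> is recovered from the time-edge that ends the first
  window of \<open>J\<close>, and \<open>K\<close> from \<open>D\<close> and that window.\<close>

lemma sum_late_le:
  assumes deg: "has_slice_degeneracy V E T \<Delta> d"
  shows "(\<Sum>x\<in>tmax_cliques. \<Sum>v\<in>fst x. card (late v (snd x))) \<le> 2 * card E * (card V * 2 ^ d)"
proof -
  let ?A = "SIGMA x:tmax_cliques. SIGMA v:fst x. late v (snd x)"
  \<comment> \<open>Slice degeneracy is available only for windows that start in
    \<open>T\<close>.\<close>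
  let ?E = "{et \<in> E. snd et - int \<Delta> \<in> points T}"
  let ?cl = "\<lambda>et. static_cliques V (slice_edges E \<Delta> (snd et - int \<Delta>))"
  let ?B = "SIGMA et:?E. fst et \<times> ?cl et"
  \<comment> \<open>As edges are unordered, the endpoint \<open>v\<close> is recorded as well; its
    two possible values are the source of the factor 2.\<close>
  let ?h = "\<lambda>(x, (v, (w, J))). (({v, w}, fst J + int \<Delta>), (v, fst x))"
  have finD: "finite (fst x)" if "x \<in> tmax_cliques" for x
    using that finite_subset[OF tmaxD(1) finite_V] by (auto simp: tmax_cliques_def)
  have finE: "finite ?E"
    using finite_E by simp
  have edge: "finite (fst et)" "card (fst et) = 2" if "et \<in> ?E" for et
  proof -
    have "et \<in> {e. e \<subseteq> V \<and> card e = 2} \<times> points T"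
      using that graph unfolding temporal_graph_def by blast
    then have "fst et \<subseteq> V \<and> card (fst et) = 2"
      by auto
    then show "finite (fst et)" "card (fst et) = 2"
      using finite_V finite_subset by auto
  qed
  have finB: "finite ?B"
    by (intro finite_SigmaI finE finite_cartesian_product edge(1) finite_static_cliques[OF finite_V])
  have member: "\<exists>D K v w J. y = ((D, K), (v, (w, J))) \<and> tmax D K \<and> D \<noteq> {} \<and>
      v \<in> D \<and> (w, J) \<in> late v K"
    if "y \<in> ?A" for y
    using that unfolding tmax_cliques_def by (cases y) force
  have "(\<Sum>x\<in>tmax_cliques. \<Sum>v\<in>fst x. card (late v (snd x)))
      = (\<Sum>x\<in>tmax_cliques. card (SIGMA v:fst x. late v (snd x)))"
    using finD neighborhood_split(4) by (intro sum.cong) auto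
  also have "\<dots> = card ?A"
    using finD neighborhood_split(4) finite_tmax_cliques by (intro card_SigmaI[symmetric]) auto
  also have "\<dots> \<le> card ?B"
  proof (rule card_inj_on_le[of ?h])
    show "inj_on ?h ?A"
    proof (rule inj_onI)
      fix y y' assume y: "y \<in> ?A" and y': "y' \<in> ?A" and h: "?h y = ?h y'"
      obtain D K v w J where yeq: "y = ((D, K), (v, (w, J)))"
        and D: "tmax D K" and J: "(w, J) \<in> late v K"
        using member[OF y] by blast
      obtain D' K' v' w' J' where yeq': "y' = ((D', K'), (v', (w', J')))"
        and D': "tmax D' K'" and J': "(w', J') \<in> late v' K'"
        using member[OF y'] by blast
      have eq: "v = v'" "w = w'" "D = D'" "fst J = fst J'"
        using h unfolding yeq yeq' by (auto simp: doubleton_eq_iff)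
      \<comment> \<open>Both intervals contain the first window of \<open>J\<close> and belong to
        the same vertex set.\<close>
      have "K = K'"
        using tmax_unique[OF D, of K' "(fst J, fst J + int \<Delta>)"] D' lateD(2,3)[OF J] lateD(2,3)[OF J']
          eq by simp
      moreover have "J = J'"
        using late_unique[OF J] J' eq \<open>K = K'\<close> by simp
      ultimately show "y = y'"
        using eq unfolding yeq yeq' by simp
    qed
    show "?h ` ?A \<subseteq> ?B"
    proof (rule image_subsetI)
      fix y assume y: "y \<in> ?A"
      obtain D K v w J where yeq: "y = ((D, K), (v, (w, J)))"
        and D: "tmax D K" "D \<noteq> {}" and v: "v \<in> D" and J: "(w, J) \<in> late v K"
        using member[OF y] by blast
      have "D \<in> static_cliques V (slice_edges E \<Delta> (fst J))"
        using tmax_static_clique[OF D, of "fst J"] lateD(2,3)[OF J] by simp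
      moreover have "fst J \<in> points T"
        using lateD(2,3)[OF J] tmaxD(3)[OF D(1)] by (simp add: points_eq)
      ultimately show "?h y \<in> ?B"
        using lateD(1)[OF J] unfolding yeq by simp
    qed
  qed (rule finB)
  also have "\<dots> = (\<Sum>et\<in>?E. card (fst et \<times> ?cl et))"
    using finE edge(1) finite_static_cliques[OF finite_V] by (intro card_SigmaI) auto
  also have "\<dots> \<le> (\<Sum>et\<in>?E. 2 * (card V * 2 ^ d))"
  proof (rule sum_mono)
    fix et assume et: "et \<in> ?E"
    then have "card (?cl et) \<le> card V * 2 ^ d"
      using card_slice_cliques_le[OF deg] by blast
    then show "card (fst et \<times> ?cl et) \<le> 2 * (card V * 2 ^ d)"
      using edge(2)[OF et] by (simp add: card_cartesian_product)
  qed
  also have "\<dots> = card ?E * (2 * (card V * 2 ^ d))"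
    by simp
  also have "\<dots> \<le> card E * (2 * (card V * 2 ^ d))"
    using finite_E by (intro mult_right_mono card_mono) auto
  finally show ?thesis
    by (simp add: ac_simps)
qed

lemma sum_charge_le:
  assumes deg: "has_slice_degeneracy V E T \<Delta> d"
  shows "sum charge tmax_cliques \<le> (17 * (1 + card E) + 4 * card E) * (windows * (card V * 2 ^ d))"
proof -
  have "sum charge tmax_cliques = card tmax_cliques * (17 * (1 + card E)) +
      2 * windows * (\<Sum>x\<in>tmax_cliques. \<Sum>v\<in>fst x. card (late v (snd x)))"
    unfolding charge_def sum.distrib sum_distrib_left[symmetric] by (simp add: algebra_simps)
  also have "\<dots> \<le> windows * (card V * 2 ^ d) * (17 * (1 + card E)) +
      2 * windows * (2 * card E * (card V * 2 ^ d))"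
    by (intro add_mono mult_right_mono mult_left_mono card_tmax_cliques_le[OF deg]
        sum_late_le[OF deg]) simp_all
  finally show ?thesis
    by (simp add: algebra_simps)
qed

section \<open>The initial call\<close>

abbreviation start :: "'v vertex_interval set" where
  "start \<equiv> {(v, T) | v. v \<in> V}"

lemma start_eq: "start = (\<lambda>v. (v, T)) ` V"
  by auto

lemma finite_start: "finite start"
  unfolding start_eq using finite_V by simp

lemma card_start: "card start = card V"
  unfolding start_eq by (simp add: card_image inj_on_def)

text \<open>A set of at most one vertex is subject to no contact condition, so all of
  \<open>T\<close> is a run.\<close>

lemma tmax_root:
  assumes "int \<Delta> \<le> duration T" "C \<subseteq> V" "\<forall>u\<in>C. \<forall>v\<in>C. u = v"
  shows "tmax C T"
proof -
  have "run \<Delta> (joint E \<Delta> C) T"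
    using assms by (auto simp: run_def joint_def duration_eq)
  then show ?thesis
    using assms(2) by (auto simp: tmax_def maximal_run_def intro: inside_antisym)
qed

text \<open>The invariant at the root: a single vertex is time-maximal on \<open>T\<close> and on no
  other interval.\<close>

lemma start_ext:
  assumes "int \<Delta> \<le> duration T"
  shows "start \<union> {} = ext {} T"
proof -
  have "(w, J) \<in> ext {} T \<longleftrightarrow> w \<in> V \<and> J = T" for w J
  proof
    assume "(w, J) \<in> ext {} T"
    note J = extD[OF this]
    have "tmax {w} T"
      using assms J(1) by (intro tmax_root) auto
    then have "T = J"
      using tmax_unique[of "{w}" T J J] J tmaxD(4)[OF J(3)] by simp
    then show "w \<in> V \<and> J = T"
      using J(1) by simp
  next
    assume "w \<in> V \<and> J = T"
    then show "(w, J) \<in> ext {} T"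
      using tmax_root[OF assms, of "{w}"] by (simp add: ext_def)
  qed
  then show ?thesis
    by (intro set_eqI) (auto simp: split_paired_all)
qed

lemma visited_start:
  assumes "int \<Delta> \<le> duration T"
  shows "visited start {} = tmax_cliques"
proof -
  have "(D, K) \<in> visited start {} \<longleftrightarrow> (D, K) \<in> tmax_cliques" for D K
    using tmaxD(1,3)[of D K] unfolding visited_def tmax_cliques_def by auto
  then show ?thesis
    by (intro set_eqI) (simp add: split_paired_all)
qed

lemma long_execution:
  assumes ord: "valid_order pick" and len: "int \<Delta> \<le> duration T"
    and call: "bk_call E \<Delta> pick start ({}, T) {} out n"
  shows "distinct out" "set out = {(C, I). maximal_delta_clique V E T \<Delta> C I}"
    "n \<le> 3 + card V + sum charge tmax_cliques"
proof -
  have T: "tmax {} T"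
    using tmax_root[OF len] by simp
  have ex: "distinct out \<and>
      set out = {x \<in> insert ({}, T) tmax_cliques. maximal_delta_clique V E T \<Delta> (fst x) (snd x)} \<and>
      n \<le> test_cost start {} + copy_cost ({} :: 'v set) + 1 + sum charge tmax_cliques"
    using execution(1)[OF ord call, unfolded fst_conv snd_conv, OF T start_ext[OF len]]
    unfolding visited_start[OF len] .
  then show "distinct out"
    by blast
  show "n \<le> 3 + card V + sum charge tmax_cliques"
    using ex card_start by (simp add: test_cost_def copy_cost_def)
  \<comment> \<open>Nonempty maximal cliques are among those visited; for the empty vertex set,
    time-maximality forces the interval \<open>T\<close>, which is the clique of the root
    call.\<close>
  have "x \<in> insert ({}, T) tmax_cliques" if "maximal_delta_clique V E T \<Delta> (fst x) (snd x)" for x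
  proof (cases "fst x = {}")
    case True
    have "tmax {} (snd x)"
      using that True by (simp add: maximal_iff)
    then have "snd x = T"
      using tmax_unique[of "{}" "snd x" T "snd x"] T tmaxD[of "{}" "snd x"] by simp
    then show ?thesis
      using True by (metis insertI1 prod.collapse)
  next
    case False
    then show ?thesis
      using that by (cases x) (simp add: maximal_iff tmax_cliques_def)
  qed
  then show "set out = {(C, I). maximal_delta_clique V E T \<Delta> C I}"
    using ex unfolding case_prod_beta by blast
qed

lemma bk_loop_empty: "bk_loop E \<Delta> pick {} R X out n \<Longrightarrow> n = 1"
  by (erule bk_loop.cases) simp_all

text \<open>If the lifetime is shorter than one window, all neighbourhoods are empty.\<close>

lemma short_loop:
  assumes ord: "valid_order pick" and short: "\<not> int \<Delta> \<le> duration T"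
    and "finite P" "P \<subseteq> start" "bk_loop E \<Delta> pick P ({}, T) X out n"
  shows "n \<le> 1 + card P * (9 + card E)"
  using assms(3-)
proof (induction "card P" arbitrary: P X out n)
  case 0
  then show ?case
    using bk_loop_empty[of pick "({}, T)" X out n] by simp
next
  case (Suc k)
  from Suc.prems(3) show ?case
  proof (cases rule: bk_loop.cases)
    case finish
    then show ?thesis
      by simp
  next
    case (iterate v I' N out1 n1 out2 n2)
    have v: "(v, I') \<in> P"
      using ord iterate unfolding valid_order_def by metis
    then have "I' = T"
      using Suc.prems(2) by auto
    have "(w, J) \<notin> N" for w J
      using neighborhoodD(2,3)[of w J v I'] short iterate \<open>I' = T\<close> by (auto simp: duration_eq)
    then have N: "N = {}"
      by (metis ex_in_conv surj_pair)
    have "bk_call E \<Delta> pick {} (insert v {}, I') {} out1 n1"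
      using iterate N by (simp add: cut_empty)
    \<comment> \<open>1 for the test, 2 for reporting a single vertex, 1 for the empty loop.\<close>
    then have n1: "n1 \<le> 4"
      by (cases rule: bk_call.cases)
        (auto simp: test_cost_def copy_cost_def dest: bk_loop_empty)
    have "card (P - {(v, I')}) = k"
      using Suc.hyps(2) v Suc.prems(1) by simp
    then have n2: "n2 \<le> 1 + k * (9 + card E)"
      using Suc.hyps(1)[of "P - {(v, I')}" "insert (v, I') X" out2 n2] Suc.prems(1,2) iterate by auto
    have "n = 1 + copy_cost ({} :: 'v set) + neighborhood_cost E \<Delta> v I' +
        cut_cost P N + cut_cost X N + n1 + n2"
      using iterate by simp
    \<comment> \<open>With \<open>N\<close> empty, 9 is 4 for the recursive call plus five constant
      terms: one for the iteration and one each for the copy, the neighborhood and the two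
      cuts.\<close>
    also have "\<dots> \<le> (9 + card E) + n2"
      using n1 N iterate by (simp add: copy_cost_def neighborhood_cost_def cut_cost_def)
    finally show ?thesis
      using n2 Suc.hyps(2)[symmetric] by simp
  qed
qed

lemma short_execution:
  assumes ord: "valid_order pick" and short: "\<not> int \<Delta> \<le> duration T"
    and call: "bk_call E \<Delta> pick start ({}, T) {} out n"
  shows "n \<le> 3 + card V + card V * (9 + card E)"
proof -
  have loop: "m \<le> 1 + card V * (9 + card E)" if "bk_loop E \<Delta> pick start ({}, T) {} out' m" for out' m
    using short_loop[OF ord short finite_start order_refl that] card_start by simp
  from call show ?thesis
    by (cases rule: bk_call.cases)
      (use loop card_start in \<open>fastforce simp: test_cost_def copy_cost_def\<close>)+
qed

section \<open>The bound on the total number of steps\<close>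

lemma cost_le:
  assumes deg: "has_slice_degeneracy V E T \<Delta> d" and ord: "valid_order pick"
    and run: "bron_kerbosch_delta V E T \<Delta> pick out n"
  shows "real n \<le> 100 * (3 powr (real d / 3) * 2 ^ d *
    max 1 (real (card V)) * max 1 (real_of_int (duration T)) * max 1 (real (card E)))"
proof -
  let ?v = "max 1 (card V)" and ?l = "max 1 (nat (duration T))" and ?m = "max 1 (card E)"
  let ?X = "2 ^ d * ?v * ?l * ?m"
  obtain k where call: "bk_call E \<Delta> pick start ({}, T) {} out k" and n: "n = 1 + card V + card E + k"
    using run unfolding bron_kerbosch_delta_def by blast
  \<comment> \<open>Setting some factors to 1 bounds each lower-order term by \<open>?X\<close>; the
    maxima with 1 make this possible.\<close>
  have bound: "a * b * c * e \<le> ?X" if "a \<le> 2 ^ d" "b \<le> ?v" "c \<le> ?l" "e \<le> ?m" for a b c e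
    using that by (intro mult_le_mono) auto
  have ge1: "1 \<le> ?X"
    using bound[of 1 1 1 1] by simp
  have vX: "card V \<le> ?X" and mX: "card E \<le> ?X" and vmX: "card V * card E \<le> ?X"
    using bound[of 1 "card V" 1 1] bound[of 1 1 1 "card E"] bound[of 1 "card V" 1 "card E"] by simp_all
  have pv: "2 ^ d * card V * ?l * 1 \<le> ?X" "2 ^ d * card V * ?l * card E \<le> ?X"
    by (intro bound; simp)+
  \<comment> \<open>The constant is generous: the terms add up to 83 for a long lifetime and to 17
    for a short one.\<close>
  have "n \<le> 100 * ?X"
  proof (cases "int \<Delta> \<le> duration T")
    case True
    \<comment> \<open>There are \<open>duration T + 1\<close> time labels, which is at most twice
      the duration once the duration is positive; for duration 0 the maximum with 1 helps.\<close>
    have "windows \<le> 2 * ?l"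
      by (auto simp: windows_def duration_eq)
    then have "windows * (card V * 2 ^ d) \<le> 2 * ?l * (card V * 2 ^ d)"
      by (rule mult_right_mono) simp
    then have "(17 * (1 + card E) + 4 * card E) * (windows * (card V * 2 ^ d)) \<le>
        (17 * (1 + card E) + 4 * card E) * (2 * ?l * (card V * 2 ^ d))"
      by (rule mult_left_mono) simp
    also have "\<dots> = 34 * (2 ^ d * card V * ?l * 1) + 42 * (2 ^ d * card V * ?l * card E)"
      by (simp add: algebra_simps)
    also have "\<dots> \<le> 76 * ?X"
      using pv by linarith
    finally have "sum charge tmax_cliques \<le> 76 * ?X"
      using sum_charge_le[OF deg] by (rule le_trans[rotated])
    then show ?thesis
      using long_execution(3)[OF ord True call] n ge1 vX mX by linarith
  next
    case False
    have "k \<le> 3 + 10 * card V + card V * card E"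
      using short_execution[OF ord False call] by (simp add: algebra_simps)
    then show ?thesis
      using n ge1 vX mX vmX by linarith
  qed
  then have "real n \<le> real (100 * ?X)"
    by (rule of_nat_mono)
  \<comment> \<open>The factor \<open>3 powr (real d / 3)\<close> is at least 1 and only enlarges
    the bound.\<close>
  also have "\<dots> \<le> 100 * (3 powr (real d / 3) * real ?X)"
    using mult_right_mono[of 1 "3 powr (real d / 3)" "real ?X"] by (simp add: ge_one_powr_ge_zero)
  also have "real ?X = 2 ^ d * max 1 (real (card V)) * max 1 (real_of_int (duration T)) *
      max 1 (real (card E))"
  proof -
    have "max 1 (real (nat (duration T))) = max 1 (real_of_int (duration T))"
      by (cases "0 \<le> duration T") auto
    then show ?thesis
      by (simp add: of_nat_max)
  qed
  finally show ?thesis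
    by (simp only: mult.assoc)
qed

end

theorem theorem3:
  shows "\<exists>c::real. \<forall>(V :: 'v set) (E :: 'v time_edges) (T :: interval) (\<Delta> :: nat) (d :: nat)
           (pick :: 'v iteration_order).
     temporal_graph V E T \<longrightarrow> has_slice_degeneracy V E T \<Delta> d \<longrightarrow> valid_order pick \<longrightarrow>
       (\<exists>out n. bron_kerbosch_delta V E T \<Delta> pick out n) \<and>
       (\<forall>out n. bron_kerbosch_delta V E T \<Delta> pick out n \<longrightarrow>
          (int \<Delta> \<le> duration T \<longrightarrow>
             distinct out \<and> set out = {(C, I). maximal_delta_clique V E T \<Delta> C I}) \<and>
          real n \<le> c * (3 powr (real d / 3) * 2 ^ d *
             max 1 (real (card V)) * max 1 (real_of_int (duration T)) * max 1 (real (card E))))"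
proof (intro exI[of _ 100] allI impI)
  fix V :: "'v set" and E :: "'v time_edges" and T :: interval and \<Delta> d :: nat
    and pick :: "'v iteration_order"
  assume graph: "temporal_graph V E T" and deg: "has_slice_degeneracy V E T \<Delta> d"
    and ord: "valid_order pick"
  interpret temporal V E T \<Delta>
    using graph by unfold_locales
  obtain out n where loop: "bk_loop E \<Delta> pick start ({}, T) {} out n"
    using terminates[OF ord finite_start] by blast
  have "\<exists>out n. bk_call E \<Delta> pick start ({}, T) {} out n"
    using bk_call_bk_loop.report[OF _ loop] bk_call_bk_loop.no_report[OF _ loop] by blast
  then have "\<exists>out n. bron_kerbosch_delta V E T \<Delta> pick out n"
    unfolding bron_kerbosch_delta_def by blast
  moreover have "distinct out \<and> set out = {(C, I). maximal_delta_clique V E T \<Delta> C I}"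
    if "bron_kerbosch_delta V E T \<Delta> pick out n" "int \<Delta> \<le> duration T" for out n
    using that long_execution(1,2)[OF ord that(2)] unfolding bron_kerbosch_delta_def by blast
  ultimately show "(\<exists>out n. bron_kerbosch_delta V E T \<Delta> pick out n) \<and>
       (\<forall>out n. bron_kerbosch_delta V E T \<Delta> pick out n \<longrightarrow>
          (int \<Delta> \<le> duration T \<longrightarrow>
             distinct out \<and> set out = {(C, I). maximal_delta_clique V E T \<Delta> C I}) \<and>
          real n \<le> 100 * (3 powr (real d / 3) * 2 ^ d *
             max 1 (real (card V)) * max 1 (real_of_int (duration T)) * max 1 (real (card E))))"
    using cost_le[OF deg ord] by blast
qed

end
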